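(* Let $\overline\omega_{2160}=\{\mathbf x_1,\ldots,\mathbf x_{2160}\}\subset S^7\subset\mathbb R^8$ be the $2_{41}$ polytope, i.e. the set of $2160$ vectors consisting of: the $1120$ vectors with four zero coordinates and four coordinates equal to $\pm\frac12$; the $16$ vectors $\pm\mathbf e_i$, $i=1,\ldots,8$; and the $1024$ vectors having seven coordinates equal to $\pm\frac14$, one coordinate equal to $\pm\frac34$, and an odd number of negative coordinates. Let $\overline\omega_{240}\subset S^7$ be the set of $240$ vectors consisting of the $112$ vectors with six zero coordinates and two coordinates equal to $\pm\frac{1}{\sqrt2}$, and the $128$ vectors with all coordinates equal to $\pm\frac{1}{2\sqrt2}$ and an even number of minus signs. Let $g$ be an admissible potential function with non-negative derivatives $g^{(8)}$, $g^{(9)}$, $g^{(10)}$ on $(-1,1)$. Then for every $\mathbf x^\ast\in\overline\omega_{240}$, $$\min_{\mathbf x\in S^7}\sum_{i=1}^{2160}g(\mathbf x\cdot\mathbf x_i)=\sum_{i=1}^{2160}g(\mathbf x^\ast\cdot\mathbf x_i).$$ If, in addition, $g^{(10)}>0$ on $(-1,1)$, then this absolute minimum is attained only at points of $\overline\omega_{240}$.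
   Context: $S^7$ is the unit sphere in $\mathbb R^8$ and $\mathbf e_1,\ldots,\mathbf e_8$ the standard basis. A function $g:[-1,1]\to(-\infty,\infty]$ is an admissible potential function if $g$ is continuous on $[-1,1)$, $g(1)=\lim_{t\to1^-}g(t)$, and $g$ is differentiable in $(-1,1)$. *)

theory Defs
  imports "HOL-Analysis.Analysis"
begin

definition omega_2160 :: "(real ^ 8) set" where
  "omega_2160 =
     {x. card {i. x $ i = 0} = 4 \<and> card {i. \<bar>x $ i\<bar> = 1/2} = 4} \<union>
     {x. \<exists>i. x = axis i 1 \<or> x = - axis i 1} \<union>
     {x. card {i. \<bar>x $ i\<bar> = 1/4} = 7 \<and> card {i. \<bar>x $ i\<bar> = 3/4} = 1 \<and> odd (card {i. x $ i < 0})}"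

definition omega_240 :: "(real ^ 8) set" where
  "omega_240 =
     {x. card {i. x $ i = 0} = 6 \<and> card {i. \<bar>x $ i\<bar> = 1 / sqrt 2} = 2} \<union>
     {x. (\<forall>i. \<bar>x $ i\<bar> = 1 / (2 * sqrt 2)) \<and> even (card {i. x $ i < 0})}"

text \<open>
  A potential maps \<open>[-1, 1]\<close> to \<open>(-\<infinity>, \<infinity>]\<close>; its values outside \<open>[-1, 1]\<close> are never used.
  Continuity on \<open>[-1, 1)\<close> refers to the topology of the extended reals, so an infinite value
  at \<open>-1\<close> is not excluded. Differentiability at a point includes finiteness there, which has to be
  demanded separately because \<^const>\<open>real_of_ereal\<close> sends \<open>\<infinity>\<close> to \<open>0\<close>.
\<close>

definition admissible_potential :: "(real \<Rightarrow> ereal) \<Rightarrow> bool" where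
  "admissible_potential g \<longleftrightarrow>
     (\<forall>t\<in>{-1..1}. g t \<noteq> -\<infinity>) \<and>
     continuous_on {-1..<1} g \<and>
     (g \<longlongrightarrow> g 1) (at_left 1) \<and>
     (\<forall>t\<in>{-1<..<1}. g t \<noteq> \<infinity>) \<and>
     (\<lambda>t. real_of_ereal (g t)) differentiable_on {-1<..<1}"

text \<open>
  The \<open>n\<close>-th derivative of a potential; meaningful at points of \<open>(-1, 1)\<close> provided that the
  derivatives of lower order are differentiable on \<open>(-1, 1)\<close>.
\<close>

definition nth_deriv :: "nat \<Rightarrow> (real \<Rightarrow> ereal) \<Rightarrow> real \<Rightarrow> real" where
  "nth_deriv n g = (deriv ^^ n) (\<lambda>t. real_of_ereal (g t))"

definition potential_2160 :: "(real \<Rightarrow> ereal) \<Rightarrow> real ^ 8 \<Rightarrow> ereal" where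
  "potential_2160 g x = (\<Sum>y\<in>omega_2160. g (x \<bullet> y))"

lemma finite_omega_2160: "finite omega_2160"
proof -
  let ?V = "{0, 1/2, -1/2, 1, -1, 1/4, -1/4, 3/4, -3/4} :: real set"
  have all: "i \<in> A \<union> B" if "card A + card B = 8" "A \<inter> B = {}" for A B :: "8 set" and i
  proof -
    have "card (A \<union> B) = CARD(8)"
      using that by (simp add: card_Un_disjoint)
    then have "A \<union> B = UNIV"
      using card_eq_UNIV_imp_eq_UNIV[of "A \<union> B"] by simp
    then show ?thesis by simp
  qed
  have "x $ i \<in> ?V" if "x \<in> omega_2160" for x i
    using that unfolding omega_2160_def
  proof (elim UnE)
    assume "x \<in> {x. card {i. x $ i = 0} = 4 \<and> card {i. \<bar>x $ i\<bar> = 1/2} = 4}"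
    then have "i \<in> {i. x $ i = 0} \<union> {i. \<bar>x $ i\<bar> = 1/2}"
      by (intro all) auto
    then show ?thesis by auto
  next
    assume "x \<in> {x. \<exists>i. x = axis i 1 \<or> x = - axis i 1}"
    then show ?thesis by (auto simp: axis_def split: if_splits)
  next
    assume "x \<in> {x. card {i. \<bar>x $ i\<bar> = 1/4} = 7 \<and> card {i. \<bar>x $ i\<bar> = 3/4} = 1 \<and>
      odd (card {i. x $ i < 0})}"
    then have "i \<in> {i. \<bar>x $ i\<bar> = 1/4} \<union> {i. \<bar>x $ i\<bar> = 3/4}"
      by (intro all) auto
    then show ?thesis by auto
  qed
  then have "omega_2160 \<subseteq> vec_lambda ` ((UNIV :: 8 set) \<rightarrow> ?V)"
    by (intro subsetI image_eqI[where x = "vec_nth _"] Pi_I) (simp_all only: vec_nth_inverse)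
  moreover have "finite ((UNIV :: 8 set) \<rightarrow> ?V)"
    using finite_PiE[of "UNIV :: 8 set" "\<lambda>_. ?V"] unfolding PiE_UNIV_domain by simp
  ultimately show ?thesis
    using finite_surj by blast
qed

end

theory Submission
  imports Defs "HOL-Computational_Algebra.Polynomial"
begin

text \<open>
  For \<open>x \<in> omega_240\<close> the inner products with \<open>omega_2160\<close> are the five numbers \<open>0\<close>, \<open>\<plusminus>1/(2 sqrt 2)\<close>, \<open>\<plusminus>1/sqrt 2\<close>,
  because \<open>sqrt 2 x\<close> and \<open>2 y\<close> are vectors of the lattice \<open>E\<^sub>8\<close>. The polynomial \<open>p\<close> of degree at most \<open>9\<close> that
  interpolates \<open>g\<close> doubly at these nodes lies below \<open>g\<close>, as \<open>g\<^sup>(\<^sup>1\<^sup>0\<^sup>)\<close> is nonnegative, so it suffices to minimise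
  \<open>\<Sum>p(x \<bullet> y)\<close>. On the sphere the moments \<open>M\<^sub>k(x) = \<Sum>(x \<bullet> y)\<^sup>k\<close> with \<open>k \<le> 9\<close>, \<open>k \<noteq> 8\<close>, are constant, and the
  signs of \<open>g\<^sup>(\<^sup>8\<^sup>)\<close> and \<open>g\<^sup>(\<^sup>9\<^sup>)\<close> make the coefficient of \<open>t\<^sup>8\<close> in \<open>p\<close> nonnegative. It remains to minimise \<open>M\<^sub>8\<close>.

  Let \<open>N\<^sub>k\<close> be the corresponding moments of the normalised \<open>E\<^sub>8\<close> roots. Then \<open>M\<^sub>8 + (3/2) N\<^sub>8\<close>, \<open>N\<^sub>2\<close>, \<open>N\<^sub>4\<close> and \<open>N\<^sub>6\<close>
  are constant on the sphere, and summing \<open>t\<^sup>2 (t\<^sup>2 - 1/4)\<^sup>2 (t\<^sup>2 - 1) \<le> 0\<close> over the roots bounds \<open>N\<^sub>8\<close> from above. Equality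
  forces \<open>x\<close> to have inner products \<open>0\<close>, \<open>\<plusminus>1/2\<close>, \<open>\<plusminus>1\<close> with all roots, and then \<open>x\<close> is itself a root. If \<open>g\<^sup>(\<^sup>1\<^sup>0\<^sup>)\<close> is
  positive, the coefficient of \<open>t\<^sup>8\<close> is positive, which yields uniqueness.
\<close>

subsection \<open>Power sums over signed subsets\<close>

lemma sum_PiE_insert:
  assumes "a \<notin> I"
  shows "(\<Sum>h\<in>PiE (insert a I) (\<lambda>_. S). F h) = (\<Sum>v\<in>S. \<Sum>h\<in>PiE I (\<lambda>_. S). F (h(a := v)))"
proof -
  have "(\<Sum>h\<in>PiE (insert a I) (\<lambda>_. S). F h) =
      (\<Sum>(v, h)\<in>S \<times> PiE I (\<lambda>_. S). F (h(a := v)))"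
    unfolding PiE_insert_eq
    by (subst sum.reindex[OF inj_combinator[OF assms]]) (simp add: case_prod_beta comp_def)
  then show ?thesis by (simp add: sum.cartesian_product)
qed

text \<open>The vector \<open>h\<close> encodes an \<open>r\<close>-subset together with signs. The
  values 1, 2 and 4 of \<open>r\<close> cover the basis vectors, the D8 roots and the vectors with
  entries \<plusminus>1/2, up to scaling; \<open>r = card I\<close> gives all sign vectors.\<close>

definition ternary_sum :: "'a set \<Rightarrow> ('a \<Rightarrow> real) \<Rightarrow> nat \<Rightarrow> (real \<Rightarrow> real) \<Rightarrow> real" where
  "ternary_sum I x r f = (\<Sum>h\<in>PiE I (\<lambda>_. {-1, 0, 1}).
     if card {i \<in> I. h i \<noteq> (0::real)} = r then f (\<Sum>i\<in>I. h i * x i) else 0)"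

lemma ternary_sum_empty: "ternary_sum {} x r f = (if r = 0 then f 0 else 0)"
  by (simp add: ternary_sum_def)

text \<open>Condition on the entry of \<open>h\<close> at \<open>a\<close>: 0 leaves all
  \<open>r\<close> nonzero entries to the other indices, while \<plusminus>1 uses one of them up and
  shifts the argument by \<plusminus>\<open>x a\<close>.\<close>

lemma ternary_sum_insert:
  assumes "finite I" "a \<notin> I"
  shows "ternary_sum (insert a I) x 0 f = ternary_sum I x 0 f"
    and "ternary_sum (insert a I) x (Suc r) f = ternary_sum I x (Suc r) f +
      ternary_sum I x r (\<lambda>t. f (t + x a) + f (t - x a))"
proof -
  have c: "card {i \<in> insert a I. (h(a := v)) i \<noteq> 0} = card {i \<in> I. h i \<noteq> 0} + (if v = 0 then 0 else 1)"
    for h :: "'a \<Rightarrow> real" and v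
  proof -
    have "{i \<in> insert a I. (h(a := v)) i \<noteq> 0} =
        (if v = 0 then {i \<in> I. h i \<noteq> 0} else insert a {i \<in> I. h i \<noteq> 0})"
      using assms by auto
    then show ?thesis using assms by auto
  qed
  have s: "(\<Sum>i\<in>insert a I. (h(a := v)) i * x i) = v * x a + (\<Sum>i\<in>I. h i * x i)"
    for h :: "'a \<Rightarrow> real" and v
  proof -
    have "(\<Sum>i\<in>I. (h(a := v)) i * x i) = (\<Sum>i\<in>I. h i * x i)"
      using assms by (intro sum.cong) auto
    then show ?thesis using assms by simp
  qed
  show "ternary_sum (insert a I) x 0 f = ternary_sum I x 0 f"
    unfolding ternary_sum_def sum_PiE_insert[OF assms(2)] c s by (simp cong: if_cong)
  have "ternary_sum (insert a I) x (Suc r) f = 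
    (\<Sum>v\<in>{-1,0,1}. \<Sum>h\<in>PiE I (\<lambda>_. {-1, 0, 1}).
       if card {i \<in> I. h i \<noteq> 0} + (if v = 0 then 0 else 1) = Suc r then f (v * x a + (\<Sum>i\<in>I. h i * x i)) else 0)"
    unfolding ternary_sum_def sum_PiE_insert[OF assms(2)] c s ..
  also have "\<dots> = ternary_sum I x (Suc r) f +
     ((\<Sum>h\<in>PiE I (\<lambda>_. {-1, 0, 1}). if card {i \<in> I. h i \<noteq> 0} = r then f ((\<Sum>i\<in>I. h i * x i) + x a) else 0) +
     (\<Sum>h\<in>PiE I (\<lambda>_. {-1, 0, 1}). if card {i \<in> I. h i \<noteq> 0} = r then f ((\<Sum>i\<in>I. h i * x i) - x a) else 0))"
    unfolding ternary_sum_def by (simp add: add.commute cong: if_cong)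
  also have "((\<Sum>h\<in>PiE I (\<lambda>_. {-1, 0, 1}). if card {i \<in> I. h i \<noteq> 0} = r then f ((\<Sum>i\<in>I. h i * x i) + x a) else 0) +
     (\<Sum>h\<in>PiE I (\<lambda>_. {-1, 0, 1}). if card {i \<in> I. h i \<noteq> 0} = r then f ((\<Sum>i\<in>I. h i * x i) - x a) else 0)) =
     ternary_sum I x r (\<lambda>t. f (t + x a) + f (t - x a))"
    unfolding ternary_sum_def sum.distrib[symmetric] by (intro sum.cong) auto
  finally show "ternary_sum (insert a I) x (Suc r) f = ternary_sum I x (Suc r) f +
      ternary_sum I x r (\<lambda>t. f (t + x a) + f (t - x a))" .
qed

lemma ternary_sum_add: "ternary_sum I x r (\<lambda>t. f t + g t) = ternary_sum I x r f + ternary_sum I x r g"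
  unfolding ternary_sum_def sum.distrib[symmetric] by (intro sum.cong) auto

lemma ternary_sum_cmult: "ternary_sum I x r (\<lambda>t. c * f t) = c * ternary_sum I x r f"
  unfolding ternary_sum_def sum_distrib_left by (intro sum.cong) auto

text \<open>
  The number of \<open>r\<close>-subsets of an \<open>n\<close>-set that contain a given \<open>l\<close>-subset. The generalised binomial
  coefficient continues it to \<open>n < l\<close>, where truncated subtraction would break Pascal's rule.
\<close>

definition supersets :: "nat \<Rightarrow> nat \<Rightarrow> nat \<Rightarrow> real" where
  "supersets n r l = (if l \<le> r then (real n - real l) gchoose (r - l) else 0)"

lemma supersets_0: "supersets n 0 0 = 1" "supersets n 0 (Suc l) = 0"
  by (simp_all add: supersets_def)

lemma supersets_Suc: "supersets (Suc n) (Suc r) (Suc l) = supersets n r l"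
  by (simp add: supersets_def)

lemma supersets_pascal: "supersets (Suc n) (Suc r) l = supersets n (Suc r) l + supersets n r l"
proof -
  consider "l \<le> r" | "l = Suc r" | "l > Suc r" by linarith
  then show ?thesis
  proof cases
    case 1
    then have "Suc r - l = Suc (r - l)" by simp
    moreover have "real (Suc n) - real l = (real n - real l) + 1" by simp
    ultimately show ?thesis
      using 1 by (simp only: supersets_def gbinomial_Suc_Suc if_True le_SucI)
  qed (simp_all add: supersets_def)
qed

lemma supersets_Suc': "supersets n (Suc r) (Suc l) = supersets n r l - supersets n r (Suc l)"
  using supersets_pascal[of n r "Suc l"] by (simp add: supersets_Suc)

text \<open>
  A coordinate that takes the values \<open>\<plusminus>x\<close> with total probability \<open>q\<close> and \<open>0\<close> otherwise has even
  cumulants \<open>q x\<^sup>2\<close>, \<open>(q - 3q\<^sup>2) x\<^sup>4\<close>, \<open>(q - 15q\<^sup>2 + 30q\<^sup>3) x\<^sup>6\<close>,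
  \<open>(q - 63q\<^sup>2 + 420q\<^sup>3 - 630q\<^sup>4) x\<^sup>8\<close>. Cumulants of independent coordinates add up, and the coefficient of
  \<open>q\<^sup>l\<close> in the resulting moment collects the monomials in exactly \<open>l\<close> distinct variables.
\<close>

lemma ternary_sum_powers:
  fixes x :: "'a \<Rightarrow> real"
  defines "p \<equiv> \<lambda>m I. \<Sum>i\<in>I. x i ^ m"
  assumes "finite I"
  shows "ternary_sum I x r (\<lambda>t. 1) = 2 ^ r * supersets (card I) r 0"
    and "ternary_sum I x r (\<lambda>t. t ^ 2) = 2 ^ r * (supersets (card I) r 1 * p 2 I)"
    and "ternary_sum I x r (\<lambda>t. t ^ 4) = 2 ^ r * (supersets (card I) r 1 * p 4 I +
      supersets (card I) r 2 * (3 * p 2 I ^ 2 - 3 * p 4 I))"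
    and "ternary_sum I x r (\<lambda>t. t ^ 6) = 2 ^ r * (supersets (card I) r 1 * p 6 I +
      supersets (card I) r 2 * (15 * p 2 I * p 4 I - 15 * p 6 I) +
      supersets (card I) r 3 * (30 * p 6 I - 45 * p 2 I * p 4 I + 15 * p 2 I ^ 3))"
    and "ternary_sum I x r (\<lambda>t. t ^ 8) = 2 ^ r * (supersets (card I) r 1 * p 8 I +
      supersets (card I) r 2 * (28 * p 6 I * p 2 I + 35 * p 4 I ^ 2 - 63 * p 8 I) +
      supersets (card I) r 3 * (420 * p 8 I - 420 * p 2 I * p 6 I - 210 * p 4 I ^ 2 + 210 * p 4 I * p 2 I ^ 2) +
      supersets (card I) r 4 * (840 * p 6 I * p 2 I - 630 * p 8 I + 315 * p 4 I ^ 2 - 630 * p 4 I * p 2 I ^ 2 + 105 * p 2 I ^ 4))"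
proof -
  \<comment> \<open>One simultaneous induction: at a new index \<open>t ^ k\<close> expands into all
    lower even powers, and \<open>r\<close> may drop by one, so it has to be arbitrary.\<close>
  have "ternary_sum I x r (\<lambda>t. 1) = 2 ^ r * supersets (card I) r 0 \<and>
     ternary_sum I x r (\<lambda>t. t ^ 2) = 2 ^ r * (supersets (card I) r 1 * p 2 I) \<and>
     ternary_sum I x r (\<lambda>t. t ^ 4) = 2 ^ r * (supersets (card I) r 1 * p 4 I +
      supersets (card I) r 2 * (3 * p 2 I ^ 2 - 3 * p 4 I)) \<and>
    ternary_sum I x r (\<lambda>t. t ^ 6) = 2 ^ r * (supersets (card I) r 1 * p 6 I +
      supersets (card I) r 2 * (15 * p 2 I * p 4 I - 15 * p 6 I) +
      supersets (card I) r 3 * (30 * p 6 I - 45 * p 2 I * p 4 I + 15 * p 2 I ^ 3)) \<and>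
    ternary_sum I x r (\<lambda>t. t ^ 8) = 2 ^ r * (supersets (card I) r 1 * p 8 I +
      supersets (card I) r 2 * (28 * p 6 I * p 2 I + 35 * p 4 I ^ 2 - 63 * p 8 I) +
      supersets (card I) r 3 * (420 * p 8 I - 420 * p 2 I * p 6 I - 210 * p 4 I ^ 2 + 210 * p 4 I * p 2 I ^ 2) +
      supersets (card I) r 4 * (840 * p 6 I * p 2 I - 630 * p 8 I + 315 * p 4 I ^ 2 - 630 * p 4 I * p 2 I ^ 2 + 105 * p 2 I ^ 4))"
    using assms(2)
  proof (induction I arbitrary: r rule: finite_induct)
    case empty
    then show ?case
      by (cases r) (auto simp: ternary_sum_empty p_def supersets_def)
  next
    case (insert a I)
    have s0: "supersets n 0 1 = 0" "supersets n 0 2 = 0" "supersets n 0 3 = 0" "supersets n 0 4 = 0" for n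
      by (simp_all add: supersets_def)
    show ?case
    proof (cases r)
      case 0
      then show ?thesis
        using insert.IH[of 0] insert.hyps by (simp add: ternary_sum_insert supersets_0 s0)
    next
      case (Suc q)
      define n u where "n = card I" and "u = x a"
      have pI: "p m (insert a I) = p m I + u ^ m" for m
        using insert.hyps by (simp add: p_def u_def)
      have cI: "card (insert a I) = Suc n"
        using insert.hyps by (simp add: n_def)
      \<comment> \<open>Every count is reduced to \<open>supersets n q l\<close> with
        \<open>l \<le> 4\<close> and \<open>supersets n (Suc q) 0\<close>, after which each claim is
        a polynomial identity.\<close>
      have S: "supersets (Suc n) (Suc q) 0 = supersets n (Suc q) 0 + supersets n q 0"
        "supersets (Suc n) (Suc q) 1 = supersets n q 0"
        "supersets (Suc n) (Suc q) 2 = supersets n q 1"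
        "supersets (Suc n) (Suc q) 3 = supersets n q 2"
        "supersets (Suc n) (Suc q) 4 = supersets n q 3"
        "supersets n (Suc q) 1 = supersets n q 0 - supersets n q 1"
        "supersets n (Suc q) 2 = supersets n q 1 - supersets n q 2"
        "supersets n (Suc q) 3 = supersets n q 2 - supersets n q 3"
        "supersets n (Suc q) 4 = supersets n q 3 - supersets n q 4"
        using supersets_pascal[of n q 0] supersets_Suc[of n q] supersets_Suc'[of n q]
        by (simp_all add: eval_nat_numeral)
      have R: "ternary_sum (insert a I) x r f = ternary_sum I x (Suc q) f +
          ternary_sum I x q (\<lambda>t. f (t + u) + f (t - u))" for f
        using ternary_sum_insert(2)[OF insert.hyps] by (simp add: u_def Suc)
      \<comment> \<open>Odd powers of \<open>u\<close> cancel. The constant term keeps its factor 1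
        so that \<open>ternary_sum_cmult\<close> reduces it to the sum of the constant function
        1.\<close>
      have E2: "(t + u) ^ 2 + (t - u) ^ 2 = 2 * t ^ 2 + (2 * u ^ 2) * 1" for t
        by algebra
      have E4: "(t + u) ^ 4 + (t - u) ^ 4 = 2 * t ^ 4 + ((12 * u ^ 2) * t ^ 2 + (2 * u ^ 4) * 1)" for t
        by algebra
      have E6: "(t + u) ^ 6 + (t - u) ^ 6 = 2 * t ^ 6 + ((30 * u ^ 2) * t ^ 4 + ((30 * u ^ 4) * t ^ 2 + (2 * u ^ 6) * 1))" for t
        by algebra
      have E8: "(t + u) ^ 8 + (t - u) ^ 8 = 2 * t ^ 8 + ((56 * u ^ 2) * t ^ 6 + ((140 * u ^ 4) * t ^ 4 + ((56 * u ^ 6) * t ^ 2 + (2 * u ^ 8) * 1)))" for t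
        by algebra
      note * = insert.IH[of "Suc q", folded n_def, unfolded S] insert.IH[of q, folded n_def]
      show ?thesis
        unfolding R E2 E4 E6 E8 ternary_sum_add ternary_sum_cmult cI unfolding Suc S pI
        unfolding *[THEN conjunct1] *[THEN conjunct2, THEN conjunct1] 
           *[THEN conjunct2, THEN conjunct2, THEN conjunct1]
           *[THEN conjunct2, THEN conjunct2, THEN conjunct2, THEN conjunct1]
           *[THEN conjunct2, THEN conjunct2, THEN conjunct2, THEN conjunct2]
           power_Suc
      proof (intro conjI, goal_cases)
        case 1 then show ?case using *(1)[THEN conjunct1] *(2)[THEN conjunct1] ternary_sum_add[of I x q "\<lambda>_. 1" "\<lambda>_. 1"]
          by (simp add: algebra_simps)
      qed algebra+
    qed
  qed
  then show "ternary_sum I x r (\<lambda>t. 1) = 2 ^ r * supersets (card I) r 0"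
    and "ternary_sum I x r (\<lambda>t. t ^ 2) = 2 ^ r * (supersets (card I) r 1 * p 2 I)"
    and "ternary_sum I x r (\<lambda>t. t ^ 4) = 2 ^ r * (supersets (card I) r 1 * p 4 I +
      supersets (card I) r 2 * (3 * p 2 I ^ 2 - 3 * p 4 I))"
    and "ternary_sum I x r (\<lambda>t. t ^ 6) = 2 ^ r * (supersets (card I) r 1 * p 6 I +
      supersets (card I) r 2 * (15 * p 2 I * p 4 I - 15 * p 6 I) +
      supersets (card I) r 3 * (30 * p 6 I - 45 * p 2 I * p 4 I + 15 * p 2 I ^ 3))"
    and "ternary_sum I x r (\<lambda>t. t ^ 8) = 2 ^ r * (supersets (card I) r 1 * p 8 I +
      supersets (card I) r 2 * (28 * p 6 I * p 2 I + 35 * p 4 I ^ 2 - 63 * p 8 I) +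
      supersets (card I) r 3 * (420 * p 8 I - 420 * p 2 I * p 6 I - 210 * p 4 I ^ 2 + 210 * p 4 I * p 2 I ^ 2) +
      supersets (card I) r 4 * (840 * p 6 I * p 2 I - 630 * p 8 I + 315 * p 4 I ^ 2 - 630 * p 4 I * p 2 I ^ 2 + 105 * p 2 I ^ 4))"
    by blast+
qed

section \<open>Sign vectors of given parity\<close>

lemma sum_PiE_signs_insert:
  assumes "finite I" "a \<notin> I"
  shows "(\<Sum>\<epsilon>\<in>PiE (insert a I) (\<lambda>_. {-1, 1 :: real}). (\<Prod>i\<in>insert a I. \<epsilon> i) * f (\<Sum>i\<in>insert a I. \<epsilon> i * x i)) =
    (\<Sum>\<epsilon>\<in>PiE I (\<lambda>_. {-1, 1}). (\<Prod>i\<in>I. \<epsilon> i) * (f ((\<Sum>i\<in>I. \<epsilon> i * x i) + x a) - f ((\<Sum>i\<in>I. \<epsilon> i * x i) - x a)))"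
proof -
  have s: "(\<Sum>i\<in>insert a I. (\<epsilon>(a := v)) i * x i) = (\<Sum>i\<in>I. \<epsilon> i * x i) + v * x a" for \<epsilon> v
  proof -
    have "(\<Sum>i\<in>I. (\<epsilon>(a := v)) i * x i) = (\<Sum>i\<in>I. \<epsilon> i * x i)"
      using assms by (intro sum.cong) auto
    then show ?thesis using assms by simp
  qed
  have p: "(\<Prod>i\<in>insert a I. (\<epsilon>(a := v)) i) = v * (\<Prod>i\<in>I. \<epsilon> i)" for \<epsilon> :: "'a \<Rightarrow> real" and v
  proof -
    have "(\<Prod>i\<in>I. (\<epsilon>(a := v)) i) = (\<Prod>i\<in>I. \<epsilon> i)"
      using assms by (intro prod.cong) auto
    then show ?thesis using assms by simp
  qed
  show ?thesis
    unfolding sum_PiE_insert[OF assms(2)] s p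
    by (simp add: sum_negf right_diff_distrib sum_subtractf)
qed

text \<open>The product of the signs kills every monomial that is even in some variable. In degree
  at most \<open>card I\<close> only the product of all variables survives, with multinomial
  coefficient \<open>fact k\<close>, once for each of the \<open>2 ^ k\<close> sign vectors.\<close>

lemma sum_signed_powers:
  assumes "finite I" "k \<le> card I"
  shows "(\<Sum>\<epsilon>\<in>PiE I (\<lambda>_. {-1, 1 :: real}). (\<Prod>i\<in>I. \<epsilon> i) * (\<Sum>i\<in>I. \<epsilon> i * x i) ^ k) =
    (if k = card I then 2 ^ k * fact k * (\<Prod>i\<in>I. x i) else 0)"
  using assms
proof (induction I arbitrary: k rule: finite_induct)
  case empty
  then show ?case by simp
next
  case (insert a I)
  define P where "P f = (\<Sum>\<epsilon>\<in>PiE I (\<lambda>_. {-1, 1 :: real}). (\<Prod>i\<in>I. \<epsilon> i) * f (\<Sum>i\<in>I. \<epsilon> i * x i))" for f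
  define u where "u = x a"
  have IH: "P (\<lambda>t. t ^ m) = (if m = card I then 2 ^ m * fact m * (\<Prod>i\<in>I. x i) else 0)" if "m \<le> card I" for m
    using insert.IH[OF that] by (simp add: P_def)
  have k: "k \<le> Suc (card I)"
    using insert by simp
  have e: "(t + u) ^ k - (t - u) ^ k = (\<Sum>j\<le>k. (of_nat (k choose j) * (u ^ j - (- u) ^ j)) * t ^ (k - j))" for t
    using binomial_ring[of u t k] binomial_ring[of "-u" t k]
    by (simp add: sum_subtractf[symmetric] algebra_simps)
  have "(\<Sum>\<epsilon>\<in>PiE (insert a I) (\<lambda>_. {-1, 1 :: real}). (\<Prod>i\<in>insert a I. \<epsilon> i) * (\<Sum>i\<in>insert a I. \<epsilon> i * x i) ^ k) =
      P (\<lambda>t. (t + u) ^ k - (t - u) ^ k)"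
    unfolding P_def u_def by (rule sum_PiE_signs_insert[OF insert.hyps])
  also have "\<dots> = (\<Sum>j\<le>k. (of_nat (k choose j) * (u ^ j - (- u) ^ j)) * P (\<lambda>t. t ^ (k - j)))"
    unfolding e P_def sum_distrib_left by (subst sum.swap) (simp add: mult_ac)
  \<comment> \<open>The term \<open>j = 0\<close> cancels, \<open>j = 1\<close> contributes only in
    top degree, and for \<open>j > 1\<close> the degree \<open>k - j\<close> is below
    \<open>card I\<close>, where \<open>P\<close> vanishes.\<close>
  also have "\<dots> = (\<Sum>j\<le>k. if j = 1 \<and> k = Suc (card I) then 2 ^ k * fact k * (u * (\<Prod>i\<in>I. x i)) else 0)"
  proof (intro sum.cong refl)
    fix j assume j: "j \<in> {..k}"
    consider "j = 0" | "j = 1" | "j > 1" by linarith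
    then show "(of_nat (k choose j) * (u ^ j - (- u) ^ j)) * P (\<lambda>t. t ^ (k - j)) =
      (if j = 1 \<and> k = Suc (card I) then 2 ^ k * fact k * (u * (\<Prod>i\<in>I. x i)) else 0)"
    proof cases
      case 2
      then have *: "k - j \<le> card I" and "k - j = card I \<longleftrightarrow> k = Suc (card I)"
        using k j by auto
      then show ?thesis
        using 2 unfolding IH[OF *] by (auto simp: fact_Suc algebra_simps)
    next
      case 3
      then have *: "k - j \<le> card I" "k - j \<noteq> card I"
        using k j by auto
      then show ?thesis
        using 3 unfolding IH[OF *(1)] by simp
    qed simp
  qed
  also have "\<dots> = (if k = card (insert a I) then 2 ^ k * fact k * (\<Prod>i\<in>insert a I. x i) else 0)"
  proof (cases "k = Suc (card I)")
    case True
    then show ?thesis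
      using insert.hyps by (simp add: u_def del: sum.atMost_Suc)
  qed (use insert.hyps in simp)
  finally show ?case .
qed

definition sign_sum :: "'a set \<Rightarrow> ('a \<Rightarrow> real) \<Rightarrow> bool \<Rightarrow> (real \<Rightarrow> real) \<Rightarrow> real" where
  "sign_sum I x b f = (\<Sum>\<epsilon> | \<epsilon> \<in> PiE I (\<lambda>_. {-1, 1 :: real}) \<and> even (card {i \<in> I. \<epsilon> i < 0}) = b.
     f (\<Sum>i\<in>I. \<epsilon> i * x i))"

lemma ternary_sum_full:
  assumes "finite I"
  shows "ternary_sum I x (card I) f = (\<Sum>\<epsilon>\<in>PiE I (\<lambda>_. {-1, 1 :: real}). f (\<Sum>i\<in>I. \<epsilon> i * x i))"
proof -
  have c: "card {i \<in> I. h i \<noteq> 0} = card I \<longleftrightarrow> (\<forall>i\<in>I. h i \<noteq> 0)" for h :: "'a \<Rightarrow> real"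
  proof -
    have "card {i \<in> I. h i \<noteq> 0} = card I \<longleftrightarrow> {i \<in> I. h i \<noteq> 0} = I"
      using assms card_subset_eq[of I "{i \<in> I. h i \<noteq> 0}"] by fastforce
    then show ?thesis by auto
  qed
  have "PiE I (\<lambda>_. {-1, 0, 1}) \<inter> {h. \<forall>i\<in>I. h i \<noteq> (0::real)} = PiE I (\<lambda>_. {-1, 1})"
    by (auto simp: PiE_iff) (metis zero_neq_one zero_neq_neg_one)
  then show ?thesis
    using assms unfolding ternary_sum_def c
    by (simp add: finite_PiE flip: sum.inter_filter) (simp add: Int_def)
qed

text \<open>The indicator of a parity class is half of 1 plus or minus the product of the
  signs.\<close>

lemma sign_sum_eq:
  assumes "finite I"
  shows "sign_sum I x b f = (ternary_sum I x (card I) f +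
    (if b then 1 else -1) * (\<Sum>\<epsilon>\<in>PiE I (\<lambda>_. {-1, 1 :: real}). (\<Prod>i\<in>I. \<epsilon> i) * f (\<Sum>i\<in>I. \<epsilon> i * x i))) / 2"
proof -
  have p: "(\<Prod>i\<in>I. \<epsilon> i) = (if even (card {i \<in> I. \<epsilon> i < 0}) then 1 else -1)"
    if "\<epsilon> \<in> PiE I (\<lambda>_. {-1, 1 :: real})" for \<epsilon>
  proof -
    have "(\<Prod>i\<in>I. \<epsilon> i) = (\<Prod>i\<in>I. if \<epsilon> i < 0 then -1 else 1)"
      using that by (intro prod.cong) (auto simp: PiE_iff)
    also have "\<dots> = (-1) ^ card {i \<in> I. \<epsilon> i < 0}"
      using assms by (simp add: prod.If_cases Int_def)
    finally show ?thesis by simp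
  qed
  have "sign_sum I x b f = (\<Sum>\<epsilon>\<in>PiE I (\<lambda>_. {-1, 1 :: real}).
      if even (card {i \<in> I. \<epsilon> i < 0}) = b then f (\<Sum>i\<in>I. \<epsilon> i * x i) else 0)"
    using assms unfolding sign_sum_def
    by (simp add: sum.inter_filter finite_PiE flip: Collect_conj_eq)
  also have "\<dots> = (\<Sum>\<epsilon>\<in>PiE I (\<lambda>_. {-1, 1 :: real}). (f (\<Sum>i\<in>I. \<epsilon> i * x i) +
      (if b then 1 else -1) * ((\<Prod>i\<in>I. \<epsilon> i) * f (\<Sum>i\<in>I. \<epsilon> i * x i))) / 2)"
    by (intro sum.cong refl) (simp add: p)
  finally show ?thesis
    unfolding ternary_sum_full[OF assms]
    by (cases b) (simp_all add: sum_divide_distrib[symmetric] sum.distrib sum_subtractf)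
qed

subsection \<open>The three parts of the polytope\<close>

lemma inner_vec_real: "(x :: real ^ 'n) \<bullet> y = (\<Sum>i\<in>UNIV. y $ i * x $ i)"
  by (simp add: inner_vec_def mult.commute)

lemma partition_8:
  fixes A B :: "8 set"
  assumes "card A + card B = 8" "A \<inter> B = {}"
  shows "A \<union> B = UNIV"
proof -
  have "card (A \<union> B) = CARD(8)"
    using assms by (simp add: card_Un_disjoint)
  then show ?thesis
    using card_eq_UNIV_imp_eq_UNIV[of "A \<union> B"] by simp
qed

lemma card_Compl_8: "card (- A :: 8 set) = 8 - card A"
  by (simp add: Compl_eq_Diff_UNIV card_Diff_subset)

definition omega_A :: "(real ^ 8) set" where
  "omega_A = {x. card {i. x $ i = 0} = 4 \<and> card {i. \<bar>x $ i\<bar> = 1/2} = 4}"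

definition omega_B :: "(real ^ 8) set" where
  "omega_B = {x. \<exists>i. x = axis i 1 \<or> x = - axis i 1}"

definition omega_C :: "(real ^ 8) set" where
  "omega_C = {x. card {i. \<bar>x $ i\<bar> = 1/4} = 7 \<and> card {i. \<bar>x $ i\<bar> = 3/4} = 1 \<and> odd (card {i. x $ i < 0})}"

lemma omega_2160_eq: "omega_2160 = omega_A \<union> omega_B \<union> omega_C"
  unfolding omega_2160_def omega_A_def omega_B_def omega_C_def ..

lemma omega_A_coord:
  assumes "y \<in> omega_A"
  shows "y $ i \<in> {-1/2, 0, 1/2}"
proof -
  have "i \<in> {i. y $ i = 0} \<union> {i. \<bar>y $ i\<bar> = 1/2}"
    using assms by (subst partition_8) (auto simp: omega_A_def)
  then show ?thesis by auto
qed

lemma omega_A_nonzero: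
  assumes "y \<in> omega_A"
  shows "\<exists>i. \<bar>y $ i\<bar> = 1/2"
proof -
  have "{i. \<bar>y $ i\<bar> = 1/2} \<noteq> {}"
    using assms unfolding omega_A_def by (metis (mono_tags) card.empty mem_Collect_eq zero_neq_numeral)
  then show ?thesis by auto
qed

lemma omega_B_coord: "y \<in> omega_B \<Longrightarrow> y $ i \<in> {-1, 0, 1}"
  by (auto simp: omega_B_def axis_def)

lemma omega_C_E:
  assumes "y \<in> omega_C"
  obtains j where "\<And>i. \<bar>y $ i\<bar> = (if i = j then 3/4 else 1/4)"
proof -
  have c: "card {i. \<bar>y $ i\<bar> = 1/4} = 7" "card {i. \<bar>y $ i\<bar> = 3/4} = 1"
    using assms by (auto simp: omega_C_def)
  then have u: "{i. \<bar>y $ i\<bar> = 1/4} \<union> {i. \<bar>y $ i\<bar> = 3/4} = UNIV"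
    by (intro partition_8) auto
  obtain j where j: "{i. \<bar>y $ i\<bar> = 3/4} = {j}"
    using c(2) by (auto simp: card_1_singleton_iff)
  have "\<bar>y $ i\<bar> = (if i = j then 3/4 else 1/4)" for i
  proof -
    have "i \<in> {i. \<bar>y $ i\<bar> = 1/4} \<or> i = j" "i \<in> {i. \<bar>y $ i\<bar> = 3/4} \<longleftrightarrow> i = j"
      using u j by blast+
    then show ?thesis by auto
  qed
  then show thesis by (rule that)
qed

lemma omega_disjoint: "omega_A \<inter> omega_B = {}" "(omega_A \<union> omega_B) \<inter> omega_C = {}"
proof -
  show "omega_A \<inter> omega_B = {}"
  proof safe
    fix y assume y: "y \<in> omega_A" "y \<in> omega_B"
    obtain i where "\<bar>y $ i\<bar> = 1/2"
      using omega_A_nonzero[OF y(1)] by blast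
    then show "y \<in> {}"
      using omega_B_coord[OF y(2), of i] by auto
  qed
  have False if y: "y \<in> omega_A \<union> omega_B" "y \<in> omega_C" for y
  proof -
    obtain j where "\<bar>y $ j\<bar> = 3/4"
      using omega_C_E[OF y(2)] by metis
    moreover have "y $ j \<in> {-1/2, 0, 1/2} \<union> {-1, 0, 1}"
      using y(1) omega_A_coord omega_B_coord by blast
    ultimately show False by auto
  qed
  then show "(omega_A \<union> omega_B) \<inter> omega_C = {}" by blast
qed

lemma ternary_sum_UNIV:
  "ternary_sum (UNIV :: 8 set) x r f =
    (\<Sum>h | (\<forall>i. h i \<in> {-1, 0, 1}) \<and> card {i. h i \<noteq> 0} = r. f (\<Sum>i\<in>UNIV. h i * x i))"
proof -
  have "finite (PiE (UNIV :: 8 set) (\<lambda>_. {-1, 0, 1 :: real}))"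
    by (intro finite_PiE) auto
  then show ?thesis
    unfolding ternary_sum_def by (subst sum.inter_filter[symmetric]) (auto simp: PiE_iff intro!: sum.cong)
qed

lemma sum_omega_A: "(\<Sum>y\<in>omega_A. f (x \<bullet> y)) = ternary_sum UNIV (($) x) 4 (\<lambda>t. f (t / 2))"
  unfolding ternary_sum_UNIV
proof (rule sum.reindex_bij_witness[of _ "\<lambda>h. \<chi> i. h i / 2" "\<lambda>y i. 2 * y $ i"])
  fix y assume y: "y \<in> omega_A"
  have "{i. 2 * y $ i \<noteq> 0} = {i. \<bar>y $ i\<bar> = 1/2}"
    using omega_A_coord[OF y] by force
  moreover have "2 * y $ i \<in> {-1, 0, 1}" for i
    using omega_A_coord[OF y, of i] by auto
  ultimately show "(\<lambda>i. 2 * y $ i) \<in> {h. (\<forall>i. h i \<in> {-1, 0, 1}) \<and> card {i. h i \<noteq> 0} = 4}"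
    using y by (simp add: omega_A_def)
next
  fix h :: "8 \<Rightarrow> real"
  assume h: "h \<in> {h. (\<forall>i. h i \<in> {-1, 0, 1}) \<and> card {i. h i \<noteq> 0} = 4}"
  have "{i. \<bar>h i / 2\<bar> = 1/2} = {i. h i \<noteq> 0}" "{i. h i / 2 = 0} = - {i. h i \<noteq> 0}"
    using h by force+
  then show "(\<chi> i. h i / 2) \<in> omega_A"
    using h by (simp add: omega_A_def card_Compl_8)
next
  fix y :: "real ^ 8"
  have "(\<Sum>i\<in>UNIV. 2 * y $ i * x $ i) / 2 = x \<bullet> y"
    by (simp add: inner_vec_real sum_divide_distrib)
  then show "f ((\<Sum>i\<in>UNIV. 2 * y $ i * x $ i) / 2) = f (x \<bullet> y)" by simp
qed (auto simp: vec_eq_iff)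

lemma sum_omega_B: "(\<Sum>y\<in>omega_B. f (x \<bullet> y)) = ternary_sum UNIV (($) x) 1 f"
  unfolding ternary_sum_UNIV
proof (rule sum.reindex_bij_witness[of _ vec_lambda vec_nth])
  fix y assume y: "y \<in> omega_B"
  then have "card {i. y $ i \<noteq> 0} = 1"
    by (auto simp: omega_B_def axis_def card_1_singleton_iff)
  then show "vec_nth y \<in> {h. (\<forall>i. h i \<in> {-1, 0, 1}) \<and> card {i. h i \<noteq> 0} = 1}"
    using omega_B_coord[OF y] by simp
next
  fix h :: "8 \<Rightarrow> real"
  assume h: "h \<in> {h. (\<forall>i. h i \<in> {-1, 0, 1}) \<and> card {i. h i \<noteq> 0} = 1}"
  then obtain j where j: "{i. h i \<noteq> 0} = {j}"
    by (auto simp: card_1_singleton_iff)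
  have "vec_lambda h = axis j (h j)"
    using j by (auto simp: axis_def vec_eq_iff)
  moreover have "h j = 1 \<or> h j = - 1"
    using h j by blast
  moreover have "axis j (- 1 :: real) = - axis j 1"
    by (simp add: axis_def vec_eq_iff)
  ultimately show "vec_lambda h \<in> omega_B"
    by (auto simp: omega_B_def)
qed (auto simp: inner_vec_real)

text \<open>The vectors of this part are \<open>(\<epsilon> + 2\<epsilon>\<^sub>j e\<^sub>j) / 4\<close> for a sign vector \<open>\<epsilon>\<close> with an odd number of minus signs.\<close>

lemma sum_omega_C: "(\<Sum>y\<in>omega_C. f (x \<bullet> y)) =
  (\<Sum>j\<in>UNIV. sign_sum UNIV (\<lambda>i. (if i = j then 3 else 1) * x $ i) False (\<lambda>t. f (t / 4)))"
proof -
  let ?E = "{\<epsilon>. \<epsilon> \<in> PiE UNIV (\<lambda>_. {-1, 1 :: real}) \<and> even (card {i \<in> (UNIV :: 8 set). \<epsilon> i < 0}) = False}"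
  let ?w = "\<lambda>(j, \<epsilon>). \<chi> i. (if i = j then 3 else 1) * \<epsilon> i / 4"
  have fin: "finite ?E"
    by (rule finite_subset[OF _ finite_PiE[of "UNIV :: 8 set" "\<lambda>_. {-1, 1 :: real}"]]) auto
  have abs: "\<bar>?w (j, \<epsilon>) $ i\<bar> = (if i = j then 3/4 else 1/4)" if "\<epsilon> \<in> ?E" for j \<epsilon> i
  proof -
    have "\<epsilon> i = -1 \<or> \<epsilon> i = 1" using that by (auto simp: PiE_iff)
    then show ?thesis by auto
  qed
  have sgn: "sgn (?w (j, \<epsilon>) $ i) = \<epsilon> i" if "\<epsilon> \<in> ?E" for j \<epsilon> i
  proof -
    have "\<epsilon> i = -1 \<or> \<epsilon> i = 1" using that by (auto simp: PiE_iff)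
    then show ?thesis by auto
  qed
  \<comment> \<open>The absolute values of the coordinates reveal \<open>j\<close>, their signs
    reveal \<open>\<epsilon>\<close>.\<close>
  have inj_w: "inj_on ?w (UNIV \<times> ?E)"
  proof (rule inj_onI)
    have inj: "j = j' \<and> \<epsilon> = \<epsilon>'" if e: "\<epsilon> \<in> ?E" "\<epsilon>' \<in> ?E" and eq: "?w (j, \<epsilon>) = ?w (j', \<epsilon>')"
      for j j' :: 8 and \<epsilon> \<epsilon>' :: "8 \<Rightarrow> real"
    proof -
      have "\<epsilon> i = \<epsilon>' i" for i
        using sgn[OF e(1), of j i] sgn[OF e(2), of j' i] unfolding eq by (rule trans[OF sym])
      moreover have "j = j'"
        using abs[OF e(1), of j j] unfolding eq abs[OF e(2)] by (simp split: if_splits)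
      ultimately show ?thesis by auto
    qed
    fix p p' assume p: "p \<in> UNIV \<times> ?E" "p' \<in> UNIV \<times> ?E" "?w p = ?w p'"
    show "p = p'"
      using p inj[of "snd p" "snd p'" "fst p" "fst p'"] by (auto simp: mem_Times_iff prod_eq_iff)
  qed
  have img_w: "?w ` (UNIV \<times> ?E) = omega_C"
  proof (intro equalityI subsetI)
    fix y assume "y \<in> ?w ` (UNIV \<times> ?E)"
    then obtain j :: 8 and \<epsilon> :: "8 \<Rightarrow> real" where y: "y = ?w (j, \<epsilon>)" and e: "\<epsilon> \<in> ?E" by auto
    have a: "\<bar>y $ i\<bar> = (if i = j then 3/4 else 1/4)" for i
      unfolding y by (rule abs[OF e])
    have "{i. \<bar>y $ i\<bar> = 1/4} = - {j}" "{i. \<bar>y $ i\<bar> = 3/4} = {j}"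
      unfolding a by auto
    moreover have "{i. y $ i < 0} = {i \<in> UNIV. \<epsilon> i < 0}"
      unfolding y by (auto simp: mult_less_0_iff)
    ultimately show "y \<in> omega_C"
      using e by (simp add: omega_C_def card_Compl_8)
  next
    fix y assume y: "y \<in> omega_C"
    obtain j where j: "\<And>i. \<bar>y $ i\<bar> = (if i = j then 3/4 else 1/4)"
      using omega_C_E[OF y] by blast
    have nz: "y $ i \<noteq> 0" for i using j[of i] by (auto split: if_splits)
    have "{i \<in> UNIV. sgn (y $ i) < 0} = {i. y $ i < 0}"
      by (auto simp: sgn_real_def)
    then have e: "(\<lambda>i. sgn (y $ i)) \<in> ?E"
      using y nz by (simp add: omega_C_def PiE_iff) (simp add: sgn_real_def)
    have yw: "y = ?w (j, \<lambda>i. sgn (y $ i))"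
    proof -
      have "?w (j, \<lambda>i. sgn (y $ i)) $ i = \<bar>y $ i\<bar> * sgn (y $ i)" for i
        unfolding j by simp
      then have "?w (j, \<lambda>i. sgn (y $ i)) $ i = y $ i" for i
        unfolding abs_mult_sgn .
      then have "?w (j, \<lambda>i. sgn (y $ i)) = y"
        by (intro vec_eq_iff[THEN iffD2] allI)
      then show ?thesis by (rule sym)
    qed
    show "y \<in> ?w ` (UNIV \<times> ?E)"
      by (rule image_eqI[where x = "(j, \<lambda>i. sgn (y $ i))"], rule yw, intro SigmaI UNIV_I e)
  qed
  have inner: "x \<bullet> ?w (j, \<epsilon>) = (\<Sum>i\<in>UNIV. \<epsilon> i * ((if i = j then 3 else 1) * x $ i)) / 4" for j \<epsilon>
    unfolding inner_vec_real sum_divide_distrib by (intro sum.cong) auto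
  have "(\<Sum>y\<in>omega_C. f (x \<bullet> y)) = (\<Sum>p\<in>UNIV \<times> ?E. f (x \<bullet> ?w p))"
    unfolding img_w[symmetric] by (rule sum.reindex[OF inj_w, unfolded comp_def])
  also have "\<dots> = (\<Sum>j\<in>UNIV. \<Sum>\<epsilon>\<in>?E. f (x \<bullet> ?w (j, \<epsilon>)))"
    unfolding sum.cartesian_product by (rule sum.cong) auto
  finally show ?thesis
    unfolding sign_sum_def inner .
qed

lemma sum_omega_2160: "(\<Sum>y\<in>omega_2160. f (x \<bullet> y)) =
  ternary_sum UNIV (($) x) 4 (\<lambda>t. f (t / 2)) + ternary_sum UNIV (($) x) 1 f +
  (\<Sum>j\<in>UNIV. sign_sum UNIV (\<lambda>i. (if i = j then 3 else 1) * x $ i) False (\<lambda>t. f (t / 4)))"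
  for f :: "real \<Rightarrow> real"
proof -
  have "finite omega_A" "finite omega_B" "finite omega_C"
    using finite_omega_2160 by (auto simp: omega_2160_eq)
  then show ?thesis
    unfolding omega_2160_eq
    by (simp add: sum.union_disjoint omega_disjoint sum_omega_A sum_omega_B sum_omega_C)
qed

subsection \<open>Moments\<close>

text \<open>The vectors of the third part are sign vectors with one coordinate tripled, up to
  scaling. Moving the factor 3 to the coordinate of \<open>x\<close> makes the formulas for plain
  sign vectors applicable, with corrected power sums.\<close>

lemma sum_triple_scaled_power:
  assumes "finite I" "j \<in> I"
  shows "(\<Sum>i\<in>I. ((if i = j then 3 else 1) * x i) ^ m) = (\<Sum>i\<in>I. x i ^ m) + (3 ^ m - 1) * (x j :: real) ^ m"
proof -
  have "(\<Sum>i\<in>I. ((if i = j then 3 else 1) * x i) ^ m) = (\<Sum>i\<in>I. x i ^ m + (if i = j then (3 ^ m - 1) * x j ^ m else 0))"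
    by (intro sum.cong) (auto simp: power_mult_distrib algebra_simps)
  also have "\<dots> = (\<Sum>i\<in>I. x i ^ m) + (3 ^ m - 1) * x j ^ m"
    using assms by (simp add: sum.distrib)
  finally show ?thesis .
qed

lemma prod_triple_scaled:
  assumes "finite I" "j \<in> I"
  shows "(\<Prod>i\<in>I. (if i = j then 3 else 1) * x i) = 3 * (\<Prod>i\<in>I. x i :: real)"
  using assms by (simp add: prod.distrib)

definition moment_2160 :: "nat \<Rightarrow> real ^ 8 \<Rightarrow> real" where
  "moment_2160 k x = (\<Sum>y\<in>omega_2160. (x \<bullet> y) ^ k)"

text \<open>
  The sum over the \<open>240\<close> normalised roots of \<open>E\<^sub>8\<close>, written as \<open>112\<close> vectors of \<open>D\<^sub>8\<close> type and \<open>128\<close> of spin type.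
\<close>

definition root_sum :: "real ^ 8 \<Rightarrow> (real \<Rightarrow> real) \<Rightarrow> real" where
  "root_sum x f = ternary_sum UNIV (($) x) 2 (\<lambda>t. f (t / sqrt 2)) +
     sign_sum UNIV (($) x) True (\<lambda>t. f (t / (2 * sqrt 2)))"

text \<open>The values 8, 4, 2 and 1 of \<open>r\<close> belong to the full sign vectors, the
  vectors with entries \<plusminus>1/2, the D8 roots and the basis vectors.\<close>

lemma supersets_8:
  "supersets 8 8 0 = 1" "supersets 8 8 1 = 1" "supersets 8 8 2 = 1" "supersets 8 8 3 = 1" "supersets 8 8 4 = 1"
  "supersets 8 4 0 = 70" "supersets 8 4 1 = 35" "supersets 8 4 2 = 15" "supersets 8 4 3 = 5" "supersets 8 4 4 = 1"
  "supersets 8 2 0 = 28" "supersets 8 2 1 = 7" "supersets 8 2 2 = 1" "supersets 8 2 3 = 0" "supersets 8 2 4 = 0"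
  "supersets 8 1 0 = 8" "supersets 8 1 1 = 1" "supersets 8 1 2 = 0" "supersets 8 1 3 = 0" "supersets 8 1 4 = 0"
proof -
  have *: "supersets 8 r l = (if l \<le> r then of_nat ((8 - l) choose (r - l)) else 0)" if "l \<le> 8" for r l
    using that by (simp add: supersets_def binomial_gbinomial of_nat_diff)
  show "supersets 8 8 0 = 1" "supersets 8 8 1 = 1" "supersets 8 8 2 = 1" "supersets 8 8 3 = 1" "supersets 8 8 4 = 1"
    "supersets 8 4 0 = 70" "supersets 8 4 1 = 35" "supersets 8 4 2 = 15" "supersets 8 4 3 = 5" "supersets 8 4 4 = 1"
    "supersets 8 2 0 = 28" "supersets 8 2 1 = 7" "supersets 8 2 2 = 1" "supersets 8 2 3 = 0" "supersets 8 2 4 = 0"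
    "supersets 8 1 0 = 8" "supersets 8 1 1 = 1" "supersets 8 1 2 = 0" "supersets 8 1 3 = 0" "supersets 8 1 4 = 0"
    by ((subst *, simp, simp add: eval_nat_numeral)+)
qed

text \<open>Below degree 8 the parity is invisible; in degree 8 the product of the coordinates
  enters with a sign given by the parity. Here 128 is the size of a parity class and 40320 is
  8!.\<close>

lemma sign_sum_powers_8:
  fixes x :: "8 \<Rightarrow> real"
  defines "p \<equiv> \<lambda>m. \<Sum>i\<in>UNIV. x i ^ m"
  shows "sign_sum UNIV x b (\<lambda>t. 1) = 128"
    and "sign_sum UNIV x b (\<lambda>t. t ^ 2) = 128 * p 2"
    and "sign_sum UNIV x b (\<lambda>t. t ^ 4) = 128 * (3 * p 2 ^ 2 - 2 * p 4)"
    and "sign_sum UNIV x b (\<lambda>t. t ^ 6) = 128 * (16 * p 6 - 30 * p 2 * p 4 + 15 * p 2 ^ 3)"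
    and "sign_sum UNIV x b (\<lambda>t. t ^ 8) = 128 * (448 * p 2 * p 6 - 272 * p 8 + 140 * p 4 ^ 2 - 420 * p 4 * p 2 ^ 2 + 105 * p 2 ^ 4)
       + (if b then 1 else -1) * (128 * 40320 * (\<Prod>i\<in>UNIV. x i))"
proof -
  have *: "sign_sum UNIV x b (\<lambda>t. t ^ k) = (ternary_sum UNIV x 8 (\<lambda>t. t ^ k) +
    (if b then 1 else -1) * (if k = 8 then 2 ^ k * fact k * (\<Prod>i\<in>UNIV. x i) else 0)) / 2" if "k \<le> 8" for k
    using sum_signed_powers[of UNIV k x] that by (simp add: sign_sum_eq)
  have "CARD(8) = 8" by simp
  note ts = ternary_sum_powers[of UNIV x 8, folded p_def, unfolded this supersets_8]
  show "sign_sum UNIV x b (\<lambda>t. 1) = 128"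
    using *[of 0] ts(1) by simp
  show "sign_sum UNIV x b (\<lambda>t. t ^ 2) = 128 * p 2"
    using *[of 2] ts(2) by (simp add: p_def)
  show "sign_sum UNIV x b (\<lambda>t. t ^ 4) = 128 * (3 * p 2 ^ 2 - 2 * p 4)"
    using *[of 4] ts(3) by (simp add: p_def)
  show "sign_sum UNIV x b (\<lambda>t. t ^ 6) = 128 * (16 * p 6 - 30 * p 2 * p 4 + 15 * p 2 ^ 3)"
    using *[of 6] ts(4) by (simp add: p_def)
  show "sign_sum UNIV x b (\<lambda>t. t ^ 8) = 128 * (448 * p 2 * p 6 - 272 * p 8 + 140 * p 4 ^ 2 - 420 * p 4 * p 2 ^ 2 + 105 * p 2 ^ 4)
       + (if b then 1 else -1) * (128 * 40320 * (\<Prod>i\<in>UNIV. x i))"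
    using *[of 8] ts(5) by (simp add: p_def fact_numeral)
qed

abbreviation (input) psum :: "real ^ 'n \<Rightarrow> nat \<Rightarrow> real" where
  "psum x m \<equiv> \<Sum>i\<in>UNIV. x $ i ^ m"

context
  fixes x :: "real ^ 8"
  assumes x: "norm x = 1"
begin

lemma psum_2: "psum x 2 = 1"
  using x by (simp add: norm_vec_def L2_set_def)

lemma triple_8:
  "(\<Sum>i\<in>UNIV. ((if i = j then 3 else 1) * x $ i) ^ m) = psum x m + (3 ^ m - 1) * x $ j ^ m"
  "(\<Prod>i\<in>UNIV. (if i = j then 3 else 1) * x $ i) = 3 * (\<Prod>i\<in>UNIV. x $ i)"
  by (rule sum_triple_scaled_power prod_triple_scaled; simp)+

lemma moment_2160_split: "moment_2160 k x = 
  ternary_sum UNIV (($) x) 4 (\<lambda>t. t ^ k) / 2 ^ k + ternary_sum UNIV (($) x) 1 (\<lambda>t. t ^ k) +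
  (\<Sum>j\<in>UNIV. sign_sum UNIV (\<lambda>i. (if i = j then 3 else 1) * x $ i) False (\<lambda>t. t ^ k)) / 4 ^ k"
proof -
  have "ternary_sum UNIV (($) x) 4 (\<lambda>t. (t / 2) ^ k) = ternary_sum UNIV (($) x) 4 (\<lambda>t. t ^ k) / 2 ^ k"
    using ternary_sum_cmult[of UNIV "($) x" 4 "1 / 2 ^ k" "\<lambda>t. t ^ k"] by (simp add: power_divide)
  moreover have "sign_sum UNIV z False (\<lambda>t. (t / 4) ^ k) = sign_sum UNIV z False (\<lambda>t. t ^ k) / 4 ^ k" for z :: "8 \<Rightarrow> real"
    by (simp add: sign_sum_def power_divide sum_divide_distrib)
  ultimately show ?thesis
    unfolding moment_2160_def sum_omega_2160[of "\<lambda>t. t ^ k"] by (simp only: sum_divide_distrib)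
qed

lemma sum_even_poly: "(\<Sum>j\<in>UNIV. a0 + a2 * x $ j ^ 2 + a4 * x $ j ^ 4 + a6 * x $ j ^ 6 + a8 * x $ j ^ 8) =
    8 * a0 + a2 * psum x 2 + a4 * psum x 4 + a6 * psum x 6 + a8 * psum x 8"
  by (simp add: sum.distrib sum_distrib_left)

text \<open>In degrees 4 and 6 the power sums cancel between the three parts, an instance of the
  design property of the polytope. In degree 8 a nonconstant expression remains.\<close>

lemma moments_2160:
  "moment_2160 0 x = 2160" "moment_2160 2 x = 270" "moment_2160 4 x = 81" "moment_2160 6 x = 135 / 4"
  "moment_2160 8 x = 135/4 * psum x 8 - 63/2 * psum x 6 - 315/16 * psum x 4 ^ 2 + 315/16 * psum x 4 + 945/64 - 1890 * (\<Prod>i\<in>UNIV. x $ i)"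
proof -
  define e where "e = (\<Prod>i\<in>UNIV. x $ i)"
  define P4 P6 P8 where "P4 = psum x 4" and "P6 = psum x 6" and "P8 = psum x 8"
  note P = P4_def[symmetric] P6_def[symmetric] P8_def[symmetric] e_def[symmetric]
  have c: "CARD(8) = 8" by simp
  note ts4 = ternary_sum_powers[of UNIV "($) x" 4, OF finite, unfolded c supersets_8 psum_2 P]
  note ts1 = ternary_sum_powers[of UNIV "($) x" 1, OF finite, unfolded c supersets_8 psum_2 P]
  note ss = sign_sum_powers_8[of "\<lambda>i. (if i = j then 3 else 1) * x $ i" for j, unfolded triple_8 psum_2 P]
  note sp = sum_even_poly[unfolded psum_2 P]
  show "moment_2160 0 x = 2160"
    unfolding moment_2160_split power_0 ts4 ts1 ss by simp
  \<comment> \<open>The sum over the position \<open>j\<close> of the tripled coordinate is taken by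
    \<open>sum_even_poly\<close>, so the summand is first written as a polynomial in
    \<open>x $ j\<close>, with zero coefficients kept to match that pattern. The same is done in
    degrees 4, 6 and 8.\<close>
  have e2: "128 * (1 + (3\<^sup>2 - 1) * (x $ j)\<^sup>2) = 128 + 1024 * x $ j ^ 2 + 0 * x $ j ^ 4 + 0 * x $ j ^ 6 + 0 * x $ j ^ 8" for j
    by simp
  show "moment_2160 2 x = 270"
    unfolding moment_2160_split ts4 ts1 ss e2 sp by simp
  have e4: "128 * (3 * (1 + (3\<^sup>2 - 1) * (x $ j)\<^sup>2)\<^sup>2 - 2 * (P4 + (3 ^ 4 - 1) * x $ j ^ 4)) =
     (384 - 256 * P4) + 6144 * x $ j ^ 2 + 4096 * x $ j ^ 4 + 0 * x $ j ^ 6 + 0 * x $ j ^ 8" for j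
    by algebra
  show "moment_2160 4 x = 81"
    unfolding moment_2160_split ts4 ts1 ss e4 sp by (simp add: field_simps)
  have e6: "128 * (16 * (P6 + (3 ^ 6 - 1) * x $ j ^ 6) - 30 * (1 + (3\<^sup>2 - 1) * (x $ j)\<^sup>2) * (P4 + (3 ^ 4 - 1) * x $ j ^ 4) +
      15 * (1 + (3\<^sup>2 - 1) * (x $ j)\<^sup>2) ^ 3) =
     128 * (16 * P6 - 30 * P4 + 15) + (128 * (360 - 240 * P4)) * x $ j ^ 2 + (128 * 480) * x $ j ^ 4 +
     (128 * 128) * x $ j ^ 6 + 0 * x $ j ^ 8" for j
    by algebra
  show "moment_2160 6 x = 135/4"
    unfolding moment_2160_split ts4 ts1 ss e6 sp by (simp add: field_simps)
  have e8: "128 * (448 * (1 + (3\<^sup>2 - 1) * (x $ j)\<^sup>2) * (P6 + (3 ^ 6 - 1) * x $ j ^ 6) - 272 * (P8 + (3 ^ 8 - 1) * x $ j ^ 8) +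
       140 * (P4 + (3 ^ 4 - 1) * x $ j ^ 4)\<^sup>2 - 420 * (P4 + (3 ^ 4 - 1) * x $ j ^ 4) * (1 + (3\<^sup>2 - 1) * (x $ j)\<^sup>2)\<^sup>2 +
       105 * (1 + (3\<^sup>2 - 1) * (x $ j)\<^sup>2) ^ 4) + (if False then 1 else - 1) * (128 * 40320 * (3 * e)) =
     (128 * (448 * P6 - 272 * P8 + 140 * P4 ^ 2 - 420 * P4 + 105 - 120960 * e)) +
     (128 * (3584 * P6 - 6720 * P4 + 3360)) * x $ j ^ 2 + (128 * (6720 - 4480 * P4)) * x $ j ^ 4 +
     (128 * 3584) * x $ j ^ 6 + (128 * 512) * x $ j ^ 8" for j
    unfolding if_False by algebra
  show "moment_2160 8 x = 135/4 * psum x 8 - 63/2 * psum x 6 - 315/16 * psum x 4 ^ 2 + 315/16 * psum x 4 + 945/64 - 1890 * (\<Prod>i\<in>UNIV. x $ i)"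
    unfolding moment_2160_split ts4 ts1 ss P e8 sp by (simp add: field_simps power2_eq_square)
qed

lemma root_sum_split: "root_sum x (\<lambda>t. t ^ (2 * k)) =
  ternary_sum UNIV (($) x) 2 (\<lambda>t. t ^ (2 * k)) / 2 ^ k + sign_sum UNIV (($) x) True (\<lambda>t. t ^ (2 * k)) / 8 ^ k"
proof -
  have "ternary_sum UNIV (($) x) 2 (\<lambda>t. (t / sqrt 2) ^ (2 * k)) = ternary_sum UNIV (($) x) 2 (\<lambda>t. t ^ (2 * k)) / 2 ^ k"
    using ternary_sum_cmult[of UNIV "($) x" 2 "1 / 2 ^ k" "\<lambda>t. t ^ (2 * k)"]
    by (simp add: power_divide power_mult)
  moreover have "sign_sum UNIV (($) x) True (\<lambda>t. (t / (2 * sqrt 2)) ^ (2 * k)) = sign_sum UNIV (($) x) True (\<lambda>t. t ^ (2 * k)) / 8 ^ k"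
    by (simp add: sign_sum_def power_divide power_mult power_mult_distrib sum_divide_distrib)
  ultimately show ?thesis
    unfolding root_sum_def by simp
qed

text \<open>Both configurations are invariant under the Weyl group of E8, whose basic invariants of
  degree at most 8 have degrees 2 and 8. Hence on the sphere the two eighth moments are affine
  functions of each other; the negative slope exchanges lower and upper bounds.\<close>

lemma root_sums:
  "root_sum x (\<lambda>t. t ^ 2) = 30" "root_sum x (\<lambda>t. t ^ 4) = 9" "root_sum x (\<lambda>t. t ^ 6) = 15 / 4"
  "root_sum x (\<lambda>t. t ^ 8) = 2 / 3 * (315 / 16 - moment_2160 8 x)"
proof -
  have c: "CARD(8) = 8" by simp
  note ts2 = ternary_sum_powers[of UNIV "($) x" 2, OF finite, unfolded c supersets_8 psum_2]
  note ss = sign_sum_powers_8[of "($) x", unfolded psum_2]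
  show "root_sum x (\<lambda>t. t ^ 2) = 30"
    using root_sum_split[of 1] unfolding mult_1_right ts2 ss by simp
  show "root_sum x (\<lambda>t. t ^ 4) = 9"
    using root_sum_split[of 2] by (simp add: ts2 ss field_simps)
  show "root_sum x (\<lambda>t. t ^ 6) = 15 / 4"
    using root_sum_split[of 3] by (simp add: ts2 ss field_simps)
  show "root_sum x (\<lambda>t. t ^ 8) = 2 / 3 * (315 / 16 - moment_2160 8 x)"
    using root_sum_split[of 4] unfolding moments_2160 by (simp add: ts2 ss field_simps)
qed

end

text \<open>
  Two unit roots have inner product \<open>0\<close>, \<open>\<plusminus>1/2\<close> or \<open>\<plusminus>1\<close>; these are the zeros of the following polynomial,
  which is nonpositive on \<open>[-1, 1]\<close>.
\<close>

definition root_annihilator :: "real \<Rightarrow> real" where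
  "root_annihilator t = t ^ 2 * (t ^ 2 - 1/4) ^ 2 * (t ^ 2 - 1)"

lemma root_annihilator_nonpos: "t ^ 2 \<le> 1 \<Longrightarrow> root_annihilator t \<le> 0"
  unfolding root_annihilator_def by (intro mult_nonneg_nonpos) auto

lemma root_sum_add: "root_sum x (\<lambda>t. f t + g t) = root_sum x f + root_sum x g"
  by (simp add: root_sum_def ternary_sum_add sign_sum_def sum.distrib)

lemma root_sum_cmult: "root_sum x (\<lambda>t. c * f t) = c * root_sum x f"
  by (simp add: root_sum_def ternary_sum_cmult sign_sum_def sum_distrib_left distrib_left)

section \<open>The minimum of the eighth moment and the points where it is attained\<close>

context
  fixes x :: "real ^ 8"
  assumes x: "norm x = 1"
begin

text \<open>The root moments of degrees 2, 4 and 6 are constant, so the sum is affine in the eighth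
  moment; 513/32 is the value at which it vanishes.\<close>

lemma root_sum_annihilator: "root_sum x root_annihilator = 2 / 3 * (513 / 32 - moment_2160 8 x)"
proof -
  have "root_annihilator t = t ^ 8 + ((- 3/2) * t ^ 6 + ((9/16) * t ^ 4 + (- 1/16) * t ^ 2))" for t
    unfolding root_annihilator_def by (simp add: field_simps power2_eq_square eval_nat_numeral)
  then have r: "root_annihilator = (\<lambda>t. t ^ 8 + ((- 3/2) * t ^ 6 + ((9/16) * t ^ 4 + (- 1/16) * t ^ 2)))"
    by blast
  show ?thesis
    unfolding r root_sum_add root_sum_cmult root_sums[OF x] by (simp add: field_simps)
qed

text \<open>The vector \<open>h / c\<close> is a unit vector, so this is the Cauchy-Schwarz
  inequality. It keeps the arguments of \<open>root_annihilator\<close> in the range where that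
  polynomial is nonpositive.\<close>

lemma scaled_inner_bound:
  assumes "(\<Sum>i\<in>UNIV. h i ^ 2) = c ^ 2" "c \<noteq> 0"
  shows "((\<Sum>i\<in>UNIV. h i * x $ i) / c) ^ 2 \<le> 1"
proof -
  have "(\<Sum>i\<in>UNIV. h i * x $ i) ^ 2 \<le> c ^ 2"
    using Cauchy_Schwarz_ineq_sum[of h "($) x" UNIV] assms(1) psum_2[OF x] by simp
  then show ?thesis
    using assms(2) by (simp add: power_divide)
qed

lemma D8_root_bound:
  assumes h: "\<forall>i. h i \<in> {-1, 0, 1}" "card {i. h i \<noteq> (0::real)} = 2"
  shows "((\<Sum>i\<in>UNIV. h i * x $ i) / sqrt 2) ^ 2 \<le> 1"
proof (rule scaled_inner_bound)
  have "(\<Sum>i\<in>UNIV. h i ^ 2) = (\<Sum>i\<in>UNIV. if h i \<noteq> 0 then 1 else 0)"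
    using h(1) by (intro sum.cong refl) (auto simp: power2_eq_1_iff)
  then show "(\<Sum>i\<in>UNIV. h i ^ 2) = (sqrt 2) ^ 2"
    using h(2) by (simp add: sum.If_cases)
qed simp

lemma spin_root_bound:
  assumes "\<epsilon> \<in> PiE UNIV (\<lambda>_. {-1, 1 :: real})"
  shows "((\<Sum>i\<in>UNIV. \<epsilon> i * x $ i) / (2 * sqrt 2)) ^ 2 \<le> 1"
proof (rule scaled_inner_bound)
  have "(\<Sum>i\<in>UNIV. \<epsilon> i ^ 2) = (\<Sum>i\<in>(UNIV :: 8 set). 1)"
    using assms by (intro sum.cong refl) (auto simp: PiE_iff power2_eq_1_iff)
  then show "(\<Sum>i\<in>UNIV. \<epsilon> i ^ 2) = (2 * sqrt 2) ^ 2"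
    by (simp add: power_mult_distrib)
qed simp

lemma root_sum_parts_nonpos:
  "ternary_sum UNIV (($) x) 2 (\<lambda>t. root_annihilator (t / sqrt 2)) \<le> 0"
  "sign_sum UNIV (($) x) True (\<lambda>t. root_annihilator (t / (2 * sqrt 2))) \<le> 0"
  unfolding ternary_sum_UNIV sign_sum_def
  by (auto intro!: sum_nonpos root_annihilator_nonpos D8_root_bound spin_root_bound)

lemma moment_8_ge: "moment_2160 8 x \<ge> 513 / 32"
  using root_sum_annihilator root_sum_parts_nonpos unfolding root_sum_def by simp

text \<open>At the minimum a sum of nonpositive terms vanishes, hence every term does.\<close>

lemma moment_8_eqD:
  assumes "moment_2160 8 x = 513 / 32"
  shows "\<lbrakk>\<forall>i. h i \<in> {-1, 0, 1}; card {i. h i \<noteq> (0::real)} = 2\<rbrakk> \<Longrightarrow>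
      root_annihilator ((\<Sum>i\<in>UNIV. h i * x $ i) / sqrt 2) = 0"
    and "\<lbrakk>\<epsilon> \<in> PiE UNIV (\<lambda>_. {-1, 1 :: real}); even (card {i. \<epsilon> i < 0})\<rbrakk> \<Longrightarrow>
      root_annihilator ((\<Sum>i\<in>UNIV. \<epsilon> i * x $ i) / (2 * sqrt 2)) = 0"
proof -
  let ?H = "{h. (\<forall>i. h i \<in> {-1, 0, 1}) \<and> card {i :: 8. h i \<noteq> (0::real)} = 2}"
  let ?E = "{\<epsilon>. \<epsilon> \<in> PiE UNIV (\<lambda>_. {-1, 1 :: real}) \<and> even (card {i \<in> (UNIV :: 8 set). \<epsilon> i < 0}) = True}"
  have fin: "finite ?H"
    by (rule finite_subset[OF _ finite_PiE[of "UNIV :: 8 set" "\<lambda>_. {-1, 0, 1 :: real}"]]) (auto simp: PiE_iff)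
  have fin': "finite ?E"
    by (rule finite_subset[OF _ finite_PiE[of "UNIV :: 8 set" "\<lambda>_. {-1, 1 :: real}"]]) auto
  have 0: "ternary_sum UNIV (($) x) 2 (\<lambda>t. root_annihilator (t / sqrt 2)) = 0"
    "sign_sum UNIV (($) x) True (\<lambda>t. root_annihilator (t / (2 * sqrt 2))) = 0"
    using root_sum_annihilator assms root_sum_parts_nonpos unfolding root_sum_def by auto
  have "\<forall>h\<in>?H. root_annihilator ((\<Sum>i\<in>UNIV. h i * x $ i) / sqrt 2) = 0"
    using 0(1) unfolding ternary_sum_UNIV
    using sum_nonneg_eq_0_iff[OF fin, of "\<lambda>h. - root_annihilator ((\<Sum>i\<in>UNIV. h i * x $ i) / sqrt 2)"]
    by (simp add: sum_negf root_annihilator_nonpos D8_root_bound)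
  then show "\<lbrakk>\<forall>i. h i \<in> {-1, 0, 1}; card {i. h i \<noteq> (0::real)} = 2\<rbrakk> \<Longrightarrow>
      root_annihilator ((\<Sum>i\<in>UNIV. h i * x $ i) / sqrt 2) = 0" by blast
  have "\<forall>\<epsilon>\<in>?E. root_annihilator ((\<Sum>i\<in>UNIV. \<epsilon> i * x $ i) / (2 * sqrt 2)) = 0"
    using 0(2) unfolding sign_sum_def
    using sum_nonneg_eq_0_iff[OF fin', of "\<lambda>\<epsilon>. - root_annihilator ((\<Sum>i\<in>UNIV. \<epsilon> i * x $ i) / (2 * sqrt 2))"]
    by (simp add: sum_negf root_annihilator_nonpos spin_root_bound)
  then show "\<lbrakk>\<epsilon> \<in> PiE UNIV (\<lambda>_. {-1, 1 :: real}); even (card {i. \<epsilon> i < 0})\<rbrakk> \<Longrightarrow>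
      root_annihilator ((\<Sum>i\<in>UNIV. \<epsilon> i * x $ i) / (2 * sqrt 2)) = 0" by simp
qed

text \<open>The scaling by \<open>2 * sqrt 2\<close> turns the zeros 0, \<plusminus>1/2,
  \<plusminus>1 into even integers.\<close>

lemma root_annihilator_zeros:
  assumes "root_annihilator (t / sqrt 2) = 0"
  shows "2 * sqrt 2 * t \<in> {-4, -2, 0, 2, 4}"
proof -
  define u where "u = 2 * sqrt 2 * t"
  have t: "(t / sqrt 2) ^ 2 = u ^ 2 / 16"
    by (simp add: u_def power_divide power_mult_distrib)
  have "u ^ 2 * (u ^ 2 - 2 ^ 2) ^ 2 * (u ^ 2 - 4 ^ 2) = 0"
    using assms unfolding root_annihilator_def t by simp
  then have "u = 0 \<or> u ^ 2 = 2 ^ 2 \<or> u ^ 2 = 4 ^ 2" by simp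
  then show ?thesis
    unfolding u_def[symmetric] power2_eq_iff by auto
qed

text \<open>In the coordinates \<open>z\<close> the squared norm is 8. The D8 roots make all
  \<open>z i \<plusminus> z j\<close> even, so the \<open>z i\<close> are integers of one common
  parity. Odd entries must all be \<plusminus>1, the spin type; even entries must be two entries
  \<plusminus>2 and six zeros, the D8 type.\<close>

lemma moment_8_eq_imp_omega_240:
  assumes m: "moment_2160 8 x = 513 / 32"
  shows "x \<in> omega_240"
proof -
  define z where "z i = 2 * sqrt 2 * x $ i" for i
  have xz: "x $ i = z i / (2 * sqrt 2)" for i
    by (simp add: z_def)
  have pair: "z i + s * z j \<in> {-4, -2, 0, 2, 4}" if "i \<noteq> j" "s \<in> {-1, 1}" for i j s
  proof -
    define h where "h k = (if k = i then 1 else if k = j then s else 0)" for k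
    have "{k. h k \<noteq> 0} = {i, j}"
      using that by (auto simp: h_def)
    then have c: "card {k. h k \<noteq> 0} = 2"
      using that by simp
    have "(\<Sum>k\<in>UNIV. h k * x $ k) = (\<Sum>k\<in>{i, j}. h k * x $ k)"
      by (rule sum.mono_neutral_right) (auto simp: h_def)
    also have "\<dots> = x $ i + s * x $ j"
      using that by (simp add: h_def)
    finally have sum: "(\<Sum>k\<in>UNIV. h k * x $ k) = x $ i + s * x $ j" .
    have "\<forall>k. h k \<in> {-1, 0, 1}"
      using that by (auto simp: h_def)
    then have "root_annihilator ((x $ i + s * x $ j) / sqrt 2) = 0"
      using moment_8_eqD(1)[OF m _ c] unfolding sum by blast
    from root_annihilator_zeros[OF this] show ?thesis
      by (simp add: z_def algebra_simps)
  qed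
  \<comment> \<open>The all-ones vector has no minus signs, so it is a spin root; it will decide the
    parity of the sign pattern.\<close>
  have "root_annihilator ((\<Sum>i\<in>UNIV. x $ i) / 2 / sqrt 2) = 0"
    using moment_8_eqD(2)[OF m, of "\<lambda>_. 1"] by (simp add: PiE_iff)
  from root_annihilator_zeros[OF this] have "(\<Sum>i\<in>UNIV. z i) / 2 \<in> {-4, -2, 0, 2, 4}"
    by (simp add: z_def sum_distrib_left[symmetric] sum_divide_distrib[symmetric])
  then have total: "(\<Sum>i\<in>UNIV. z i) \<in> {-8, -4, 0, 4, 8}"
    by auto
  have norm: "(\<Sum>i\<in>UNIV. z i ^ 2) = 8"
    using psum_2[OF x] by (simp add: z_def power_mult_distrib sum_distrib_left[symmetric])
  have zi: "z i \<in> {-4, -3, -2, -1, 0, 1, 2, 3, 4}" for i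
  proof -
    \<comment> \<open>Averaging a sum and a difference of two coordinates isolates
      \<open>z i\<close>; the second index is the successor of \<open>i\<close> in the cyclic index
      type.\<close>
    have "i + 1 \<noteq> i" by simp
    then have "i \<noteq> i + 1" by metis
    from pair[OF this, of 1] pair[OF this, of "-1"] obtain u v where
      "z i + z (i + 1) = u" "z i - z (i + 1) = v" and uv: "u \<in> {-4, -2, 0, 2, 4}" "v \<in> {-4, -2, 0, 2, 4}"
      by simp
    then have "z i = (u + v) / 2" by simp
    then show ?thesis using uv by (elim insertE emptyE; simp)
  qed
  show ?thesis
  proof (cases "\<exists>i. z i \<in> {-3, -1, 1, 3}")
    case True
    then obtain i where i: "z i \<in> {-3, -1, 1, 3}" by blast
    have odd: "z j \<in> {-3, -1, 1, 3}" for j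
    proof (cases "i = j")
      case False
      then obtain u where "z i + z j = u" and u: "u \<in> {-4, -2, 0, 2, 4}"
        using pair[of i j 1] by simp
      then have "z j = u - z i" by simp
      then have "z j \<in> {-7, -5, -3, -1, 1, 3, 5, 7}"
        using u i by (elim insertE emptyE; simp)
      then show ?thesis using zi[of j] by (elim insertE emptyE; simp)
    qed (use i in simp)
    \<comment> \<open>Eight squares of odd numbers with sum 8 are all 1.\<close>
    have "1 \<le> z j ^ 2" for j
      using odd[of j] by auto
    moreover have "(\<Sum>j\<in>UNIV. z j ^ 2 - 1) = 0"
      by (simp add: sum_subtractf norm)
    ultimately have "z j ^ 2 - 1 = 0" for j
      by (subst (asm) sum_nonneg_eq_0_iff) auto
    then have z1: "\<bar>z j\<bar> = 1" for j
      using abs_square_eq_1[of "z j"] by simp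
    have "z j = 1 - 2 * (if x $ j < 0 then 1 else 0)" for j
    proof -
      have "x $ j < 0 \<longleftrightarrow> z j < 0"
        by (simp add: z_def mult_less_0_iff)
      then show ?thesis using z1[of j] by auto
    qed
    \<comment> \<open>By \<open>total\<close> this is a multiple of 4, so the number of minus signs
      is even.\<close>
    then have "(\<Sum>j\<in>UNIV. z j) = 8 - 2 * real (card {j. x $ j < 0})"
      by (simp only: sum_subtractf sum_distrib_left[symmetric]) (simp add: sum.If_cases)
    then have "real (card {j. x $ j < 0}) \<in> {0, 2, 4, 6, 8}"
      using total by (elim insertE emptyE; simp)
    then have "card {j. x $ j < 0} \<in> {0, 2, 4, 6, 8}"
      by auto
    then have "even (card {j. x $ j < 0})" by auto
    moreover have "\<bar>x $ j\<bar> = 1 / (2 * sqrt 2)" for j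
      using z1[of j] by (simp add: xz abs_mult)
    ultimately show ?thesis
      by (simp add: omega_240_def)
  next
    case False
    then have ev: "z i \<in> {-4, -2, 0, 2, 4}" for i
      using zi[of i] by auto
    \<comment> \<open>This excludes \<plusminus>4. Each nonzero entry then contributes 4 to the
      squared norm 8, so there are two of them.\<close>
    have "z i ^ 2 \<le> (\<Sum>i\<in>UNIV. z i ^ 2)" for i
      by (rule member_le_sum) auto
    then have le8: "z i ^ 2 \<le> 8" for i
      unfolding norm .
    have z2: "z i = 0 \<or> \<bar>z i\<bar> = 2" for i
      using ev[of i] le8[of i] by auto
    have "(8 :: real) = (\<Sum>i\<in>UNIV. if z i = 0 then 0 else 4)"
      unfolding norm[symmetric]
    proof (intro sum.cong refl)
      fix i
      have "z i = 0 \<or> z i = 2 \<or> z i = -2"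
        using z2[of i] by linarith
      then show "z i ^ 2 = (if z i = 0 then 0 else 4)"
        by (elim disjE) simp_all
    qed
    also have "\<dots> = 4 * real (card (- {i. z i = 0}))"
      by (simp add: sum.If_cases Compl_eq)
    finally have c: "card (- {i. z i = 0}) = 2" by linarith
    have "\<bar>x $ i\<bar> = \<bar>z i\<bar> / 2 / sqrt 2" for i
      by (simp add: xz)
    then have "\<bar>x $ i\<bar> = 1 / sqrt 2 \<longleftrightarrow> z i \<noteq> 0" for i
      using z2[of i] by auto
    then have n: "- {i. z i = 0} = {i. \<bar>x $ i\<bar> = 1 / sqrt 2}"
      by blast
    have 0: "{i. z i = 0} = {i. x $ i = 0}"
      by (simp add: z_def)
    have card_0: "card {i. z i = 0} = 6"
      using c card_Compl_8[of "{i. z i = 0}"] by linarith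
    then show ?thesis
      using c[unfolded n] card_0[unfolded 0] by (simp add: omega_240_def)
  qed
qed

end

subsection \<open>Hermite interpolation\<close>

text \<open>Newton form: \<open>w\<close> vanishes doubly at the old nodes, so multiples of
  \<open>w\<close> and \<open>(t - a) * w\<close> can be added there freely. The first corrects the
  value at \<open>a\<close>, the second then the slope.\<close>

lemma hermite_interpolation:
  fixes f f' :: "real \<Rightarrow> real"
  assumes "finite X"
  shows "\<exists>p. degree p \<le> 2 * card X - 1 \<and> (\<forall>x\<in>X. poly p x = f x \<and> poly (pderiv p) x = f' x)"
  using assms
proof (induction X rule: finite_induct)
  case empty
  \<comment> \<open>Truncated subtraction makes the bound 0 here, which the zero polynomial
    meets.\<close>
  then show ?case by (intro exI[of _ 0]) simp
next
  case (insert a X)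
  then obtain p where p: "degree p \<le> 2 * card X - 1"
    "\<And>x. x \<in> X \<Longrightarrow> poly p x = f x" "\<And>x. x \<in> X \<Longrightarrow> poly (pderiv p) x = f' x"
    by blast
  define w where "w = (\<Prod>x\<in>X. [:-x, 1:]) ^ 2"
  define c where "c = (f a - poly p a) / poly w a"
  define d where "d = (f' a - poly (pderiv p) a - c * poly (pderiv w) a) / poly w a"
  define r where "r = p + (smult c w + smult d ([:-a, 1:] * w))"
  have "degree (\<Prod>x\<in>X. [:-x, 1:]) = card X"
    by (subst degree_prod_eq_sum_degree) auto
  moreover have "(\<Prod>x\<in>X. [:-x, 1:]) \<noteq> (0 :: real poly)"
    using insert.hyps by simp
  ultimately have deg_w: "degree w = 2 * card X"
    by (simp add: w_def degree_power_eq)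
  have wa: "poly w a \<noteq> 0"
    using insert.hyps by (auto simp: w_def poly_prod)
  have wx: "poly w x = 0" "poly (pderiv w) x = 0" if "x \<in> X" for x
    using that insert.hyps by (auto simp: w_def poly_prod pderiv_power_Suc numeral_2_eq_2 pderiv_mult)
  have pd: "poly (pderiv ([:-a, 1:] * w)) t = poly w t + (t - a) * poly (pderiv w) t" for t
    by (simp only: pderiv_mult) (simp add: pderiv_pCons algebra_simps)
  have "degree ([:-a, 1:] * w) \<le> 1 + 2 * card X"
    using degree_mult_le[of "[:-a, 1:]" w] deg_w by simp
  then have "degree r \<le> 2 * card X + 1"
    unfolding r_def using p(1) deg_w
    by (intro degree_add_le degree_smult_le[THEN order_trans]) auto
  moreover have "poly r x = f x \<and> poly (pderiv r) x = f' x" if "x \<in> insert a X" for x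
  proof (cases "x = a")
    case True
    then show ?thesis
      using wa by (simp add: r_def c_def d_def pderiv_add pderiv_smult pd del: mult_pCons_left)
  next
    case False
    then show ?thesis
      using that p wx by (simp add: r_def pderiv_add pderiv_smult pd del: mult_pCons_left)
  qed
  ultimately show ?case
    using insert.hyps by (intro exI[of _ r]) auto
qed

text \<open>Rolle between consecutive zeros. The new zeros avoid \<open>Z\<close> so that they can
  be counted together with zeros of the derivative inside \<open>Z\<close>. Bracketing by elements
  of \<open>Z\<close> keeps them in the interval and carries disjointness through the induction,
  which always adds a new maximum.\<close>

lemma Rolle_zeros:
  fixes f f' :: "real \<Rightarrow> real"
  assumes "finite Z" "Z \<subseteq> {a<..<b}"
    and "\<And>t. t \<in> {a<..<b} \<Longrightarrow> (f has_real_derivative f' t) (at t)"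
    and "\<And>z. z \<in> Z \<Longrightarrow> f z = 0"
  shows "\<exists>Z'. finite Z' \<and> Z' \<inter> Z = {} \<and> card Z \<le> card Z' + 1 \<and>
    (\<forall>z\<in>Z'. f' z = 0 \<and> (\<exists>l\<in>Z. l < z) \<and> (\<exists>u\<in>Z. z < u))"
  using assms(1,2,4)
proof (induction Z rule: finite_linorder_max_induct)
  case empty
  then show ?case by (intro exI[of _ "{}"]) simp
next
  case (insert m A)
  then obtain Z' where Z': "finite Z'" "Z' \<inter> A = {}" "card A \<le> card Z' + 1"
    "\<And>z. z \<in> Z' \<Longrightarrow> f' z = 0 \<and> (\<exists>l\<in>A. l < z) \<and> (\<exists>u\<in>A. z < u)"
    by auto
  show ?case
  proof (cases "A = {}")
    case True
    then show ?thesis by (intro exI[of _ "{}"]) simp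
  next
    case False
    define k where "k = Max A"
    have k: "k \<in> A" "\<And>u. u \<in> A \<Longrightarrow> u \<le> k"
      using False insert.hyps(1) by (auto simp: k_def)
    then have "k < m" using insert.hyps by blast
    moreover have ab: "{k..m} \<subseteq> {a<..<b}"
      using insert.prems(1) k(1) by (auto simp: subset_iff)
    ultimately have "\<exists>\<xi>. k < \<xi> \<and> \<xi> < m \<and> (\<lambda>h. f' \<xi> * h) = (\<lambda>h. 0)"
    proof (intro Rolle_deriv)
      show "f k = f m"
        using insert.prems(2) k(1) by simp
      show "continuous_on {k..m} f"
        using ab assms(3) by (intro continuous_at_imp_continuous_on ballI DERIV_isCont) blast
      show "(f has_derivative (\<lambda>h. f' t * h)) (at t)" if "k < t" "t < m" for t
      proof -
        have "t \<in> {k..m}" using that by simp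
        then have "t \<in> {a<..<b}" using ab by blast
        then show ?thesis using assms(3) by (simp add: has_field_derivative_def)
      qed
    qed
    then obtain \<xi> where \<xi>: "k < \<xi>" "\<xi> < m" "f' \<xi> = 0"
      by (metis mult.right_neutral)
    have "\<xi> \<notin> Z'" "\<xi> \<notin> A" "m \<notin> Z'"
      using Z'(4) k \<xi> insert.hyps by fastforce+
    then have "insert \<xi> Z' \<inter> insert m A = {}"
      using \<xi> Z'(2) by auto
    moreover have "card (insert m A) \<le> card (insert \<xi> Z') + 1"
      using \<open>\<xi> \<notin> Z'\<close> Z'(1,3) insert.hyps by (auto simp: card_insert_if)
    moreover have "\<forall>z\<in>insert \<xi> Z'. f' z = 0 \<and> (\<exists>l\<in>insert m A. l < z) \<and> (\<exists>u\<in>insert m A. z < u)"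
      using Z'(4) \<xi> k(1) by blast
    ultimately show ?thesis
      using Z'(1) by (intro exI[of _ "insert \<xi> Z'"]) simp
  qed
qed

lemma iterated_Rolle:
  fixes F :: "nat \<Rightarrow> real \<Rightarrow> real"
  assumes "\<And>k t. \<lbrakk>k < n; t \<in> {a<..<b}\<rbrakk> \<Longrightarrow> (F k has_real_derivative F (Suc k) t) (at t)"
    and "finite Z" "Z \<subseteq> {a<..<b}" "\<And>z. z \<in> Z \<Longrightarrow> F 0 z = 0" "card Z > n"
  shows "\<exists>\<xi>\<in>{a<..<b}. F n \<xi> = 0"
  using assms
proof (induction n arbitrary: F Z)
  case 0
  then have "Z \<noteq> {}" by auto
  then show ?case using 0 by blast
next
  case (Suc n)
  have "\<exists>Z'. finite Z' \<and> Z' \<inter> Z = {} \<and> card Z \<le> card Z' + 1 \<and>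
    (\<forall>z\<in>Z'. F 1 z = 0 \<and> (\<exists>l\<in>Z. l < z) \<and> (\<exists>u\<in>Z. z < u))"
    using Suc.prems by (intro Rolle_zeros[where f = "F 0"]) auto
  then obtain Z' where Z': "finite Z'" "card Z \<le> card Z' + 1"
    "\<And>z. z \<in> Z' \<Longrightarrow> F 1 z = 0" "\<And>z. z \<in> Z' \<Longrightarrow> (\<exists>l\<in>Z. l < z) \<and> (\<exists>u\<in>Z. z < u)"
    by blast
  have "\<exists>\<xi>\<in>{a<..<b}. (\<lambda>k. F (Suc k)) n \<xi> = 0"
  proof (rule Suc.IH)
    show "Z' \<subseteq> {a<..<b}"
      using Z'(4) Suc.prems(3) by fastforce
  qed (use Suc.prems Z' in auto)
  then show ?case .
qed

text \<open>After one derivative the zeros between elements of \<open>Z\<close> and those in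
  \<open>D\<close> are distinct and number at least \<open>card Z + card D - 1\<close>. From there
  on each derivative loses at most one zero.\<close>

lemma iterated_Rolle_double_zeros:
  fixes F :: "nat \<Rightarrow> real \<Rightarrow> real"
  assumes F: "\<And>k t. \<lbrakk>k < n; t \<in> {a<..<b}\<rbrakk> \<Longrightarrow> (F k has_real_derivative F (Suc k) t) (at t)"
    and Z: "finite Z" "Z \<subseteq> {a<..<b}" "\<And>z. z \<in> Z \<Longrightarrow> F 0 z = 0"
    and D: "D \<subseteq> Z" "\<And>z. z \<in> D \<Longrightarrow> F 1 z = 0"
    and card: "card Z + card D > n" and "n > 0"
  shows "\<exists>\<xi>\<in>{a<..<b}. F n \<xi> = 0"
proof -
  obtain m where n: "n = Suc m" using \<open>n > 0\<close> gr0_implies_Suc by blast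
  have "\<exists>Z'. finite Z' \<and> Z' \<inter> Z = {} \<and> card Z \<le> card Z' + 1 \<and>
    (\<forall>z\<in>Z'. F 1 z = 0 \<and> (\<exists>l\<in>Z. l < z) \<and> (\<exists>u\<in>Z. z < u))"
    using F[of 0] Z n by (intro Rolle_zeros[where f = "F 0"]) auto
  then obtain Z' where Z': "finite Z'" "Z' \<inter> Z = {}" "card Z \<le> card Z' + 1"
    "\<And>z. z \<in> Z' \<Longrightarrow> F 1 z = 0" "\<And>z. z \<in> Z' \<Longrightarrow> (\<exists>l\<in>Z. l < z) \<and> (\<exists>u\<in>Z. z < u)"
    by blast
  have "finite D" using D(1) Z(1) finite_subset by blast
  then have "card (Z' \<union> D) = card Z' + card D"
    using Z'(1,2) D(1) by (intro card_Un_disjoint) auto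
  moreover have "Z' \<subseteq> {a<..<b}"
    using Z'(5) Z(2) by fastforce
  ultimately have "\<exists>\<xi>\<in>{a<..<b}. (\<lambda>k. F (Suc k)) m \<xi> = 0"
    using F Z' D Z(2) \<open>finite D\<close> card n
    by (intro iterated_Rolle[where Z = "Z' \<union> D"]) auto
  then show ?thesis unfolding n .
qed

lemma poly_higher_pderiv_degree_le:
  fixes p :: "real poly"
  assumes "degree p \<le> n"
  shows "poly ((pderiv ^^ n) p) t = fact n * coeff p n"
proof -
  have "degree ((pderiv ^^ n) p) = 0"
    using assms by (simp add: degree_higher_pderiv)
  then obtain c where c: "(pderiv ^^ n) p = [:c:]"
    by (metis degree_eq_zeroE)
  have "coeff ((pderiv ^^ n) p) 0 = fact n * coeff p n"
    by (simp add: coeff_higher_pderiv pochhammer_fact)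
  then show ?thesis by (simp add: c)
qed

section \<open>The interpolation nodes and the polynomial minorant\<close>

definition nodes :: "real set" where
  "nodes = {- (1 / sqrt 2), - (1 / (2 * sqrt 2)), 0, 1 / (2 * sqrt 2), 1 / sqrt 2}"

text \<open>The largest node \<open>1 / sqrt 2\<close> is left out here.\<close>

definition node_poly :: "real poly" where
  "node_poly = [:1 / sqrt 2, 1:] * [:1 / (2 * sqrt 2), 1:] * [:0, 1:] * [:- (1 / (2 * sqrt 2)), 1:]"

lemma sqrt2_squares: "(1 / sqrt 2) ^ 2 = 1 / 2" "(1 / (2 * sqrt 2)) ^ 2 = 1 / 8"
  by (simp_all add: power_divide power_mult_distrib)

lemma nodes_facts: "finite nodes" "card nodes = 5" "nodes \<subseteq> {-1<..<1}"
  "card (nodes - {1 / sqrt 2}) = 4" "1 / sqrt 2 \<in> nodes"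
proof -
  define c where "c = 1 / sqrt 2"
  have c: "c > 0" "c < 1" "nodes = {-c, -(c / 2), 0, c / 2, c}"
    by (simp_all add: c_def nodes_def mult.commute)
  show "finite nodes" "card nodes = 5" "nodes \<subseteq> {-1<..<1}" "1 / sqrt 2 \<in> nodes"
    using c(1,2) unfolding c(3) c_def[symmetric] by auto
  then show "card (nodes - {1 / sqrt 2}) = 4" by simp
qed

lemma poly_node_poly: "x \<in> nodes - {1 / sqrt 2} \<Longrightarrow> poly node_poly x = 0"
  by (auto simp: nodes_def node_poly_def simp del: mult_pCons_left mult_pCons_right)

lemma pderiv_square_root:
  fixes v u :: "real poly"
  assumes "poly v x = 0"
  shows "poly (v\<^sup>2 * u) x = 0" "poly (pderiv (v\<^sup>2 * u)) x = 0"
  using assms by (simp_all add: pderiv_mult power2_eq_square)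

text \<open>The coefficient of \<open>t ^ 8\<close> is minus the sum of the zeros with multiplicity.
  It is positive because the largest node is counted only once and the others twice.\<close>

lemma coeffs_node_poly_9:
  defines "W \<equiv> node_poly\<^sup>2 * [:- (1 / sqrt 2), 1:]"
  shows "degree W = 9" "coeff W 9 = 1" "coeff W 8 = 1 / sqrt 2"
proof -
  define c where "c = 1 / sqrt 2"
  have "W = ([:c, 1:] * [:c / 2, 1:] * [:0, 1:] * [:- (c / 2), 1:])\<^sup>2 * [:- c, 1:]"
    by (simp add: W_def node_poly_def c_def mult.commute)
  also have "\<dots> = [:0, 0, - (c ^ 7 / 16), - (c ^ 6 / 16), 9 * c ^ 5 / 16, 9 * c ^ 4 / 16, - 3 * c ^ 3 / 2, - 3 * c\<^sup>2 / 2, c, 1:]"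
    by (simp add: power2_eq_square algebra_simps eval_nat_numeral)
  finally have W: "W = [:0, 0, - (c ^ 7 / 16), - (c ^ 6 / 16), 9 * c ^ 5 / 16, 9 * c ^ 4 / 16, - 3 * c ^ 3 / 2, - 3 * c\<^sup>2 / 2, c, 1:]" .
  show "degree W = 9" "coeff W 9 = 1" "coeff W 8 = 1 / sqrt 2"
    unfolding W by (simp_all add: eval_nat_numeral c_def)
qed

text \<open>The factor 1 gives \<open>W\<close> the shape required by
  \<open>pderiv_square_root\<close>.\<close>

lemma coeffs_node_poly_10:
  defines "W \<equiv> (node_poly * [:- (1 / sqrt 2), 1:])\<^sup>2 * 1"
  shows "degree W = 10" "coeff W 10 = 1"
proof -
  have W: "W = node_poly\<^sup>2 * [:- (1 / sqrt 2), 1:] * [:- (1 / sqrt 2), 1:]"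
    by (simp only: W_def power2_eq_square mult_ac mult_1_left)
  have nz: "node_poly\<^sup>2 * [:- (1 / sqrt 2), 1:] \<noteq> 0"
    using coeffs_node_poly_9(2) by fastforce
  show deg: "degree W = 10"
    unfolding W using nz by (subst degree_mult_eq) (simp_all only: coeffs_node_poly_9 degree_pCons_eq pCons_eq_0_iff, simp_all)
  have "lead_coeff W = 1"
    unfolding W lead_coeff_mult coeffs_node_poly_9(1) coeffs_node_poly_9(2) by simp
  then show "coeff W 10 = 1"
    unfolding deg .
qed

locale smooth_potential =
  fixes F :: "nat \<Rightarrow> real \<Rightarrow> real"
  assumes deriv_F: "\<And>k t. \<lbrakk>k < 10; t \<in> {-1<..<1}\<rbrakk> \<Longrightarrow> (F k has_real_derivative F (Suc k) t) (at t)"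
begin

text \<open>Rolle is applied to \<open>F 0\<close> minus \<open>p\<close>. The \<open>n\<close>-th
  derivative of \<open>p\<close> is constant, so a sign condition on \<open>F n\<close> passes to
  the coefficient of \<open>t ^ n\<close>.\<close>

lemma minus_poly_Rolle:
  assumes "finite Z" "Z \<subseteq> {-1<..<1}" "\<And>z. z \<in> Z \<Longrightarrow> F 0 z = poly p z"
    and "D \<subseteq> Z" "\<And>z. z \<in> D \<Longrightarrow> F 1 z = poly (pderiv p) z"
    and "card Z + card D > n" "n > 0" "n \<le> 10" "degree p \<le> n"
  shows "\<exists>\<xi>\<in>{-1<..<1}. F n \<xi> = fact n * coeff p n"
proof -
  have "\<exists>\<xi>\<in>{-1<..<1}. (\<lambda>k t. F k t - poly ((pderiv ^^ k) p) t) n \<xi> = 0"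
  proof (rule iterated_Rolle_double_zeros[where Z = Z and D = D])
    fix k t assume "k < n" "t \<in> {-1<..<1::real}"
    then show "((\<lambda>t. F k t - poly ((pderiv ^^ k) p) t) has_real_derivative
        F (Suc k) t - poly ((pderiv ^^ Suc k) p) t) (at t)"
      using assms(8) by (auto intro!: DERIV_diff deriv_F poly_DERIV)
  qed (use assms in auto)
  then show ?thesis
    using assms(9) by (simp add: poly_higher_pderiv_degree_le)
qed

lemma minorant:
  assumes "\<forall>k\<in>{8, 9, 10}. \<forall>t\<in>{-1<..<1}. F k t \<ge> 0"
  obtains p where "degree p \<le> 9" "\<forall>x\<in>nodes. F 0 x = poly p x"
    "\<forall>t\<in>{-1<..<1}. poly p t \<le> F 0 t" "coeff p 8 \<ge> 0"
    "(\<forall>t\<in>{-1<..<1}. F 10 t > 0) \<longrightarrow> coeff p 8 > 0"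
proof -
  have nonneg: "F k t \<ge> 0" if "k \<in> {8, 9, 10}" "t \<in> {-1<..<1}" for k t
    using assms that by blast
  obtain p where deg_p: "degree p \<le> 9" and p: "\<And>x. x \<in> nodes \<Longrightarrow> F 0 x = poly p x"
    and p': "\<And>x. x \<in> nodes \<Longrightarrow> F 1 x = poly (pderiv p) x"
    using hermite_interpolation[OF nodes_facts(1), of "F 0" "F 1"] nodes_facts(2) by auto
  \<comment> \<open>Five double nodes count as ten zeros, enough for a zero of the ninth
    derivative.\<close>
  obtain \<xi> where \<xi>: "\<xi> \<in> {-1<..<1}" "F 9 \<xi> = fact 9 * coeff p 9"
    using minus_poly_Rolle[of nodes p nodes 9] nodes_facts p p' deg_p by auto
  have a9: "coeff p 9 \<ge> 0"
    using nonneg[of 9 \<xi>] \<xi> by (simp add: zero_le_mult_iff not_le[THEN iffD2, OF fact_gt_zero])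
  \<comment> \<open>If \<open>F 10\<close> is positive, \<open>F 9\<close> increases strictly. It is
    nonnegative at the midpoint \<eta> of -1 and \<xi>, hence positive at \<xi>.\<close>
  have a9_pos: "coeff p 9 > 0" if pos: "\<forall>t\<in>{-1<..<1}. F 10 t > 0"
  proof -
    define \<eta> where "\<eta> = (\<xi> - 1) / 2"
    have \<eta>: "\<eta> < \<xi>" "\<eta> \<in> {-1<..<1}"
      using \<xi>(1) by (auto simp: \<eta>_def)
    have "F 9 \<eta> < F 9 \<xi>"
    proof (rule DERIV_pos_imp_increasing[OF \<eta>(1)])
      fix t assume "\<eta> \<le> t" "t \<le> \<xi>"
      then have "t \<in> {-1<..<1}" using \<eta>(2) \<xi>(1) by auto
      then show "\<exists>y. (F 9 has_real_derivative y) (at t) \<and> 0 < y"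
        using deriv_F[of 9 t] pos by auto
    qed
    moreover have "F 9 \<eta> \<ge> 0" using nonneg \<eta>(2) by simp
    ultimately have "0 < fact 9 * coeff p 9" using \<xi>(2) by simp
    then show ?thesis by (simp add: zero_less_mult_iff)
  qed
  \<comment> \<open>\<open>r\<close> interpolates doubly at all nodes but the largest one, so its leading coefficient \<open>coeff p 8 - coeff p 9 / sqrt 2\<close>
    is a value of the eighth derivative.\<close>
  define W9 where "W9 = node_poly\<^sup>2 * [:- (1 / sqrt 2), 1:]"
  note W9 = coeffs_node_poly_9[folded W9_def]
  define r where "r = p - smult (coeff p 9) W9"
  have W9_0: "poly W9 x = 0" if "x \<in> nodes" for x
    using that poly_node_poly[of x] by (cases "x = 1 / sqrt 2") (auto simp: W9_def)
  have W9_1: "poly (pderiv W9) x = 0" if "x \<in> nodes - {1 / sqrt 2}" for x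
    unfolding W9_def by (rule pderiv_square_root[OF poly_node_poly[OF that]])
  have "degree r \<le> 8"
  proof (rule degree_le, intro allI impI)
    fix i :: nat assume "i > 8"
    then consider "i = 9" | "i > 9" by linarith
    then show "coeff r i = 0"
      using deg_p W9 by cases (auto simp: r_def coeff_eq_0)
  qed
  moreover have "F 0 x = poly r x" if "x \<in> nodes" for x
    using p[OF that] W9_0[OF that] by (simp add: r_def)
  moreover have "F 1 x = poly (pderiv r) x" if "x \<in> nodes - {1 / sqrt 2}" for x
    using p'[of x] W9_1[OF that] that by (simp add: r_def pderiv_diff pderiv_smult)
  \<comment> \<open>Five zeros, four of them double, count as nine, enough for the eighth
    derivative.\<close>
  ultimately obtain \<zeta> where \<zeta>: "\<zeta> \<in> {-1<..<1}" "F 8 \<zeta> = fact 8 * coeff r 8"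
    using minus_poly_Rolle[of nodes r "nodes - {1 / sqrt 2}" 8] nodes_facts by auto
  have "coeff r 8 \<ge> 0"
    using nonneg[of 8 \<zeta>] \<zeta> by (simp add: zero_le_mult_iff not_le[THEN iffD2, OF fact_gt_zero])
  then have a8: "coeff p 8 \<ge> coeff p 9 * (1 / sqrt 2)"
    by (simp add: r_def W9)
  define W10 where "W10 = (node_poly * [:- (1 / sqrt 2), 1:])\<^sup>2 * 1"
  note W10 = coeffs_node_poly_10[folded W10_def]
  have W10_0: "poly W10 x = 0" "poly (pderiv W10) x = 0" if "x \<in> nodes" for x
  proof -
    have "poly (node_poly * [:- (1 / sqrt 2), 1:]) x = 0"
      using that poly_node_poly[of x] by (cases "x = 1 / sqrt 2") auto
    from pderiv_square_root[OF this, of 1] show "poly W10 x = 0" "poly (pderiv W10) x = 0"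
      by (simp_all only: W10_def)
  qed
  have W10_nonneg: "poly W10 t \<ge> 0" for t
    by (simp add: W10_def power_mult_distrib)
  have W10_zero: "t \<in> nodes" if "poly W10 t = 0" for t
    using that by (auto simp: W10_def node_poly_def nodes_def add_eq_0_iff2 simp del: mult_pCons_left mult_pCons_right)
  have le: "poly p t \<le> F 0 t" if t: "t \<in> {-1<..<1}" for t
  proof (cases "t \<in> nodes")
    case True
    then show ?thesis using p by simp
  next
    case False
    \<comment> \<open>With this \<open>K\<close> the polynomial \<open>q\<close> agrees with
      \<open>F 0\<close> at \<open>t\<close> as well. Together with the double nodes that makes
      eleven zeros, so \<open>fact 10 * K\<close> is a value of the tenth derivative.\<close>
    define K where "K = (F 0 t - poly p t) / poly W10 t"
    define q where "q = p + smult K W10"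
    have "poly W10 t \<noteq> 0" using W10_zero False by blast
    then have K: "F 0 t - poly p t = K * poly W10 t" by (simp add: K_def)
    have "F 0 x = poly q x" if "x \<in> insert t nodes" for x
      using that K p W10_0 by (auto simp: q_def)
    moreover have "F 1 x = poly (pderiv q) x" if "x \<in> nodes" for x
      using p'[OF that] W10_0[OF that] by (simp add: q_def pderiv_add pderiv_smult)
    moreover have "degree q \<le> 10"
      unfolding q_def using deg_p W10(1) by (intro degree_add_le degree_smult_le[THEN order_trans]) auto
    ultimately obtain \<theta> where \<theta>: "\<theta> \<in> {-1<..<1}" "F 10 \<theta> = fact 10 * coeff q 10"
      using minus_poly_Rolle[of "insert t nodes" q nodes 10] subset_insertI[of nodes t]
        nodes_facts t False by auto
    have "coeff q 10 = K"
      using deg_p W10(2) by (simp add: q_def coeff_eq_0)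
    then have "K \<ge> 0"
      using nonneg[of 10 \<theta>] \<theta> by (simp add: zero_le_mult_iff not_le[THEN iffD2, OF fact_gt_zero])
    then show ?thesis
      using K W10_nonneg[of t] by (metis diff_ge_0_iff_ge mult_nonneg_nonneg)
  qed
  show thesis
  proof (rule that)
    have "0 \<le> coeff p 9 * (1 / sqrt 2)" using a9 by simp
    then show "coeff p 8 \<ge> 0" using a8 by linarith
    show "(\<forall>t\<in>{-1<..<1}. F 10 t > 0) \<longrightarrow> coeff p 8 > 0"
    proof
      assume pos: "\<forall>t\<in>{-1<..<1}. F 10 t > 0"
      have "0 < coeff p 9 * (1 / sqrt 2)" using a9_pos[OF pos] by simp
      then show "coeff p 8 > 0" using a8 by linarith
    qed
  qed (use deg_p p le in auto)
qed

end

text \<open>Inside the interval \<open>g\<close> is finite and the real comparison carries over. At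
  the endpoints, where \<open>g\<close> may be infinite, the inequality is a limit of interior
  ones.\<close>

lemma admissible_ge_poly:
  assumes g: "admissible_potential g"
    and le: "\<And>t. t \<in> {-1<..<1} \<Longrightarrow> poly p t \<le> real_of_ereal (g t)"
    and t: "t \<in> {-1..1}"
  shows "ereal (poly p t) \<le> g t"
proof -
  have int: "ereal (poly p s) \<le> g s" if s: "s \<in> {-1<..<1}" for s
  proof -
    have "\<bar>g s\<bar> \<noteq> \<infinity>"
      using g s unfolding admissible_potential_def by auto
    then show ?thesis
      using le[OF s] by (metis ereal_less_eq(3) ereal_real')
  qed
  have lim: "((\<lambda>s. ereal (poly p s)) \<longlongrightarrow> ereal (poly p a)) (at a within S)" for a S
    by (intro tendsto_ereal isCont_tendsto_compose[OF poly_isCont] tendsto_ident_at)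
  consider "t \<in> {-1<..<1}" | "t = 1" | "t = -1" using t by fastforce
  then show ?thesis
  proof cases
    case 2
    have "(g \<longlongrightarrow> g 1) (at_left 1)"
      using g by (simp add: admissible_potential_def)
    moreover have "\<forall>\<^sub>F s in at_left 1. ereal (poly p s) \<le> g s"
      using eventually_at_left_real[of "-1" 1] by (rule eventually_mono) (use int in auto)
    ultimately show ?thesis
      unfolding 2 using lim by (intro tendsto_le[of "at_left (1::real)"]) auto
  next
    case 3
    have "(g \<longlongrightarrow> g (-1)) (at (-1) within {-1..<1})"
      using g by (simp add: admissible_potential_def continuous_on_def)
    \<comment> \<open>A closed interval allows \<open>at_within_Icc_at_right\<close> to identify the
      filter.\<close>
    then have "(g \<longlongrightarrow> g (-1)) (at (-1) within {-1..0})"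
      by (rule tendsto_within_subset) auto
    then have "(g \<longlongrightarrow> g (-1)) (at_right (-1))"
      by (simp add: at_within_Icc_at_right)
    moreover have "\<forall>\<^sub>F s in at_right (-1). ereal (poly p s) \<le> g s"
      using eventually_at_right_real[of "-1" 1] by (rule eventually_mono) (use int in auto)
    ultimately show ?thesis
      unfolding 3 using lim by (intro tendsto_le[of "at_right (-1::real)"]) auto
  qed (use int in auto)
qed

subsection \<open>Inner products between the two configurations\<close>

text \<open>Membership in the lattice \<open>E\<^sub>8\<close>, when the index type has eight elements.\<close>

definition E8_vector :: "('i::finite \<Rightarrow> real) \<Rightarrow> bool" where
  "E8_vector v \<longleftrightarrow> ((\<forall>i. v i \<in> \<int>) \<or> (\<forall>i. v i - 1/2 \<in> \<int>)) \<and> (\<Sum>i\<in>UNIV. v i) / 2 \<in> \<int>"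

text \<open>Half-integral coordinates are shifted by 1/2. The shift produces half the coordinate sum
  of the other vector, an integer by definition; if both vectors are half-integral, the remaining
  constant is eight quarters.\<close>

lemma E8_vector_inner:
  fixes u v :: "8 \<Rightarrow> real"
  assumes "E8_vector u" "E8_vector v"
  shows "(\<Sum>i\<in>UNIV. u i * v i) \<in> \<int>"
proof -
  have mixed: "(\<Sum>i\<in>UNIV. u i * v i) \<in> \<int>"
    if "\<forall>i. u i \<in> \<int>" "(\<Sum>i\<in>UNIV. u i) / 2 \<in> \<int>" "\<forall>i. v i - 1/2 \<in> \<int>" for u v :: "8 \<Rightarrow> real"
  proof -
    have "(\<Sum>i\<in>UNIV. u i * v i) = (\<Sum>i\<in>UNIV. u i * (v i - 1/2)) + (\<Sum>i\<in>UNIV. u i) / 2"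
      by (simp add: right_diff_distrib sum_subtractf sum_divide_distrib)
    also have "\<dots> \<in> \<int>"
      using that by (intro Ints_add Ints_sum Ints_mult) auto
    finally show ?thesis .
  qed
  consider "\<forall>i. u i \<in> \<int>" "\<forall>i. v i \<in> \<int>" | "\<forall>i. u i \<in> \<int>" "\<forall>i. v i - 1/2 \<in> \<int>"
    | "\<forall>i. u i - 1/2 \<in> \<int>" "\<forall>i. v i \<in> \<int>" | "\<forall>i. u i - 1/2 \<in> \<int>" "\<forall>i. v i - 1/2 \<in> \<int>"
    using assms unfolding E8_vector_def by blast
  then show ?thesis
  proof cases
    case 1
    then show ?thesis by (intro Ints_sum Ints_mult) auto
  next
    case 2
    then show ?thesis using assms mixed by (simp add: E8_vector_def)
  next
    case 3
    then show ?thesis using assms mixed[of v u] by (simp add: E8_vector_def mult.commute)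
  next
    case 4
    have "(\<Sum>i\<in>UNIV. u i * v i) =
        (\<Sum>i\<in>UNIV. (u i - 1/2) * (v i - 1/2) + u i / 2 + v i / 2 - 1/4)"
      by (intro sum.cong) (auto simp: field_simps)
    also have "\<dots> = (\<Sum>i\<in>UNIV. (u i - 1/2) * (v i - 1/2)) + (\<Sum>i\<in>UNIV. u i) / 2 + (\<Sum>i\<in>UNIV. v i) / 2 - 2"
      by (simp add: sum.distrib sum_subtractf sum_divide_distrib)
    finally have eq: "(\<Sum>i\<in>UNIV. u i * v i) = (\<Sum>i\<in>UNIV. (u i - 1/2) * (v i - 1/2)) + (\<Sum>i\<in>UNIV. u i) / 2 + (\<Sum>i\<in>UNIV. v i) / 2 - 2" .
    have "(\<Sum>i\<in>UNIV. (u i - 1/2) * (v i - 1/2)) \<in> \<int>"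
      using 4 by (intro Ints_sum Ints_mult) auto
    then have "(\<Sum>i\<in>UNIV. (u i - 1/2) * (v i - 1/2)) + (\<Sum>i\<in>UNIV. u i) / 2 + (\<Sum>i\<in>UNIV. v i) / 2 - 2 \<in> \<int>"
      using assms unfolding E8_vector_def by (intro Ints_add Ints_diff) auto
    then show ?thesis unfolding eq .
  qed
qed

text \<open>Passing from an integer to its absolute value changes it by an even amount.\<close>

lemma E8_vector_int:
  assumes "\<And>i. v i \<in> \<int>" "(\<Sum>i\<in>UNIV. \<bar>v i\<bar>) / 2 \<in> \<int>"
  shows "E8_vector v"
proof -
  have "(\<bar>v i\<bar> - v i) / 2 \<in> \<int>" for i
    using assms(1)[of i] by (cases "v i \<ge> 0") auto
  then have "(\<Sum>i\<in>UNIV. \<bar>v i\<bar>) / 2 - (\<Sum>i\<in>UNIV. (\<bar>v i\<bar> - v i) / 2) \<in> \<int>"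
    using assms(2) by (intro Ints_diff Ints_sum) auto
  then have "(\<Sum>i\<in>UNIV. v i) / 2 \<in> \<int>"
    by (simp add: sum_divide_distrib[symmetric] sum_subtractf diff_divide_distrib)
  then show ?thesis
    using assms(1) by (simp add: E8_vector_def)
qed

text \<open>Flipping the sign of a half-integer changes it by an odd amount, which is why the number
  of negative entries enters.\<close>

lemma E8_vector_half_int:
  assumes "\<And>i. \<bar>v i\<bar> - 1/2 \<in> \<int>" "((\<Sum>i\<in>UNIV. \<bar>v i\<bar>) - real (card {i. v i < 0})) / 2 \<in> \<int>"
  shows "E8_vector v"
proof -
  have "(\<Sum>i\<in>UNIV. v i) / 2 = (\<Sum>i\<in>UNIV. \<bar>v i\<bar> / 2 - (if v i < 0 then 1/2 else 0) - (if v i < 0 then \<bar>v i\<bar> - 1/2 else 0))"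
    unfolding sum_divide_distrib by (intro sum.cong) auto
  also have "\<dots> = ((\<Sum>i\<in>UNIV. \<bar>v i\<bar>) - real (card {i. v i < 0})) / 2 - (\<Sum>i\<in>UNIV. (if v i < 0 then \<bar>v i\<bar> - 1/2 else 0))"
    by (simp add: sum_subtractf sum_divide_distrib[symmetric] sum.If_cases diff_divide_distrib)
  also have "\<dots> \<in> \<int>"
  proof (intro Ints_diff Ints_sum)
    show "(if v i < 0 then \<bar>v i\<bar> - 1/2 else 0) \<in> \<int>" for i
      using assms(1)[of i] by (cases "v i < 0") simp_all
  qed (use assms(2) in auto)
  finally have "(\<Sum>i\<in>UNIV. v i) / 2 \<in> \<int>" .
  moreover have "v i - 1/2 \<in> \<int>" for i
  proof (cases "v i < 0")
    case True
    have "- (\<bar>v i\<bar> - 1/2) - 1 \<in> \<int>"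
      by (rule Ints_diff[OF Ints_minus[OF assms(1)] Ints_1])
    then show ?thesis using True by simp
  qed (use assms(1)[of i] in simp)
  ultimately show ?thesis
    by (simp add: E8_vector_def)
qed

lemma two_values_sum:
  fixes x :: "real ^ 8"
  assumes "card {i. x $ i = 0} = m" "card {i. \<bar>x $ i\<bar> = c} = n" "m + n = 8" "c \<noteq> 0"
  shows "(\<Sum>i\<in>UNIV. f \<bar>x $ i\<bar>) = real m * f 0 + real n * f c"
    and "\<And>i. \<bar>x $ i\<bar> = 0 \<or> \<bar>x $ i\<bar> = c"
proof -
  have u: "{i. x $ i = 0} \<union> {i. \<bar>x $ i\<bar> = c} = UNIV"
    using assms by (intro partition_8) auto
  then show "\<bar>x $ i\<bar> = 0 \<or> \<bar>x $ i\<bar> = c" for i by auto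
  have "(\<Sum>i\<in>UNIV. f \<bar>x $ i\<bar>) = (\<Sum>i | x $ i = 0. f \<bar>x $ i\<bar>) + (\<Sum>i | \<bar>x $ i\<bar> = c. f \<bar>x $ i\<bar>)"
    unfolding u[symmetric] using assms(4) by (intro sum.union_disjoint) auto
  also have "\<dots> = real m * f 0 + real n * f c"
    using assms by simp
  finally show "(\<Sum>i\<in>UNIV. f \<bar>x $ i\<bar>) = real m * f 0 + real n * f c" .
qed

lemma omega_240_cases:
  assumes "x \<in> omega_240"
  obtains "card {i. x $ i = 0} = 6" "card {i. \<bar>x $ i\<bar> = 1 / sqrt 2} = 2"
  | "\<And>i. \<bar>x $ i\<bar> = 1 / (2 * sqrt 2)" "even (card {i. x $ i < 0})"
  using assms unfolding omega_240_def by blast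

lemma E8_vector_omega_240:
  assumes "x \<in> omega_240"
  shows "E8_vector (\<lambda>i. sqrt 2 * x $ i)"
  using assms
proof (cases rule: omega_240_cases)
  case 1
  note two = two_values_sum[OF 1]
  show ?thesis
  proof (rule E8_vector_int)
    fix i
    have "\<bar>x $ i\<bar> = 0 \<or> \<bar>x $ i\<bar> = 1 / sqrt 2"
      by (rule two(2)) auto
    then have "\<bar>sqrt 2 * x $ i\<bar> = 0 \<or> \<bar>sqrt 2 * x $ i\<bar> = 1"
      by (auto simp: abs_mult)
    then show "sqrt 2 * x $ i \<in> \<int>"
      by (auto simp: abs_eq_iff' simp del: mult_eq_0_iff)
  next
    have "(\<Sum>i\<in>UNIV. \<bar>sqrt 2 * x $ i\<bar>) = 2"
      using two(1)[of "\<lambda>t. sqrt 2 * t"] by (simp add: abs_mult)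
    then show "(\<Sum>i\<in>UNIV. \<bar>sqrt 2 * x $ i\<bar>) / 2 \<in> \<int>" by simp
  qed
next
  case 2
  have a: "\<bar>sqrt 2 * x $ i\<bar> = 1/2" for i
    by (simp add: abs_mult 2)
  have n: "{i. sqrt 2 * x $ i < 0} = {i. x $ i < 0}"
    by (simp add: mult_less_0_iff)
  obtain k where k: "card {i. x $ i < 0} = 2 * k"
    using 2(2) by blast
  show ?thesis
    by (rule E8_vector_half_int) (simp_all add: a n k diff_divide_distrib)
qed

lemma E8_vector_omega_2160:
  assumes "y \<in> omega_2160"
  shows "E8_vector (\<lambda>i. 2 * y $ i)"
  using assms unfolding omega_2160_eq
proof (elim UnE)
  assume y: "y \<in> omega_A"
  show ?thesis
  proof (rule E8_vector_int)
    show "2 * y $ i \<in> \<int>" for i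
    proof -
      have "2 * y $ i = -1 \<or> 2 * y $ i = 0 \<or> 2 * y $ i = 1"
        using omega_A_coord[OF y, of i] by auto
      then show ?thesis by (elim disjE; simp only:; simp)
    qed
    have "card {i. y $ i = 0} = 4" "card {i. \<bar>y $ i\<bar> = 1/2} = 4"
      using y by (auto simp: omega_A_def)
    from two_values_sum(1)[OF this, of "\<lambda>t. 2 * t"]
    have "(\<Sum>i\<in>UNIV. \<bar>2 * y $ i\<bar>) = 4" by (simp add: abs_mult)
    then show "(\<Sum>i\<in>UNIV. \<bar>2 * y $ i\<bar>) / 2 \<in> \<int>" by simp
  qed
next
  assume y: "y \<in> omega_B"
  show ?thesis
  proof (rule E8_vector_int)
    show i: "2 * y $ i \<in> \<int>" for i
      using omega_B_coord[OF y, of i] by auto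
    have "(\<Sum>i\<in>UNIV. \<bar>2 * y $ i\<bar>) / 2 = (\<Sum>i\<in>UNIV. \<bar>y $ i\<bar>)"
      by (simp add: abs_mult sum_divide_distrib)
    also have "\<dots> \<in> \<int>"
    proof (rule Ints_sum)
      show "\<bar>y $ i\<bar> \<in> \<int>" for i
        using omega_B_coord[OF y, of i] by auto
    qed
    finally show "(\<Sum>i\<in>UNIV. \<bar>2 * y $ i\<bar>) / 2 \<in> \<int>" .
  qed
next
  assume y: "y \<in> omega_C"
  obtain j where j: "\<And>i. \<bar>y $ i\<bar> = (if i = j then 3/4 else 1/4)"
    using omega_C_E[OF y] by blast
  have a: "\<bar>2 * y $ i\<bar> = 1/2 + (if i = j then 1 else 0)" for i
    by (simp add: abs_mult j)
  have n: "{i. 2 * y $ i < 0} = {i. y $ i < 0}"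
    by (simp add: mult_less_0_iff)
  obtain k where k: "card {i. y $ i < 0} = 2 * k + 1"
    using y by (auto simp: omega_C_def elim: oddE)
  \<comment> \<open>The absolute values add up to 5, odd like the number of minus signs.\<close>
  have "((\<Sum>i\<in>UNIV. \<bar>2 * y $ i\<bar>) - real (card {i. 2 * y $ i < 0})) / 2 = 2 - real k"
    unfolding a n k by (simp add: sum.distrib)
  then show ?thesis
    by (intro E8_vector_half_int) (simp_all only: a, simp_all)
qed

text \<open>These are the quantities from which \<open>moments_2160\<close> computes the eighth
  moment. Exponent 0 is excluded because \<open>0 ^ 0 = 1\<close>. In the spin case the even number
  of minus signs makes the product positive.\<close>

lemma omega_240_even_power_sums:
  assumes "x \<in> omega_240"
  obtains "\<And>m. m > 0 \<Longrightarrow> (\<Sum>i\<in>UNIV. x $ i ^ (2 * m)) = 2 / 2 ^ m" "(\<Prod>i\<in>UNIV. x $ i) = 0"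
  | "\<And>m. m > 0 \<Longrightarrow> (\<Sum>i\<in>UNIV. x $ i ^ (2 * m)) = 8 / 8 ^ m" "(\<Prod>i\<in>UNIV. x $ i) = 1 / 8 ^ 4"
  using assms(1)
proof (cases rule: omega_240_cases)
  case 1
  have "(\<Sum>i\<in>UNIV. x $ i ^ (2 * m)) = 2 / 2 ^ m" if "m > 0" for m
  proof -
    have "(\<Sum>i\<in>UNIV. (\<bar>x $ i\<bar> ^ 2) ^ m) = 2 * ((1 / sqrt 2) ^ 2) ^ m"
      using that by (subst two_values_sum(1)[OF 1]) auto
    then show ?thesis by (simp add: power_mult sqrt2_squares(1) power_divide)
  qed
  moreover have "(\<Prod>i\<in>UNIV. x $ i) = 0"
  proof -
    have "{i. x $ i = 0} \<noteq> {}" using 1(1) by (metis card.empty zero_neq_numeral)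
    then show ?thesis by (intro prod_zero) auto
  qed
  ultimately show ?thesis by (rule that(1))
next
  case 2
  have "(\<Sum>i\<in>UNIV. x $ i ^ (2 * m)) = 8 / 8 ^ m" for m
  proof -
    have "x $ i ^ (2 * m) = 1 / 8 ^ m" for i
      using 2(1)[of i] by (metis power2_abs power_mult power_one_over sqrt2_squares(2))
    then show ?thesis by simp
  qed
  moreover have "(\<Prod>i\<in>UNIV. x $ i) = 1 / 8 ^ 4"
  proof -
    have "(\<Prod>i\<in>UNIV. x $ i) = (\<Prod>i\<in>UNIV. (if x $ i < 0 then -1 else 1) * (1 / (2 * sqrt 2)))"
    proof (intro prod.cong refl)
      show "x $ i = (if x $ i < 0 then -1 else 1) * (1 / (2 * sqrt 2))" for i
        using 2(1)[of i] by (auto simp: abs_if split: if_splits)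
    qed
    also have "\<dots> = (-1) ^ card {i. x $ i < 0} * (1 / (2 * sqrt 2)) ^ 8"
      by (simp only: prod.distrib) (simp add: prod.If_cases)
    also have "\<dots> = ((1 / (2 * sqrt 2)) ^ 2) ^ 4"
      using 2(2) by (simp flip: power_mult)
    finally show ?thesis unfolding sqrt2_squares(2) by (simp add: power_divide)
  qed
  ultimately show ?thesis by (intro that(2)) auto
qed

lemma norm_omega_240:
  assumes "x \<in> omega_240"
  shows "norm x = 1"
proof -
  have "(\<Sum>i\<in>UNIV. x $ i ^ (2 * 1)) = 1"
  proof (cases rule: omega_240_even_power_sums[OF assms])
    case 1
    from 1(1)[of 1] show ?thesis by simp
  next
    case 2
    from 2(1)[of 1] show ?thesis by simp
  qed
  then show ?thesis by (simp add: norm_vec_def L2_set_def)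
qed

lemma moment_8_omega_240:
  assumes "x \<in> omega_240"
  shows "moment_2160 8 x = 513 / 32"
proof -
  have m: "moment_2160 8 x = 135/4 * (\<Sum>i\<in>UNIV. x $ i ^ (2 * 4)) - 63/2 * (\<Sum>i\<in>UNIV. x $ i ^ (2 * 3)) -
     315/16 * (\<Sum>i\<in>UNIV. x $ i ^ (2 * 2)) ^ 2 + 315/16 * (\<Sum>i\<in>UNIV. x $ i ^ (2 * 2)) + 945/64
     - 1890 * (\<Prod>i\<in>UNIV. x $ i)"
    using moments_2160(5)[OF norm_omega_240[OF assms]] by simp
  show ?thesis
  proof (cases rule: omega_240_even_power_sums[OF assms])
    case 1
    show ?thesis unfolding m 1(2) 1(1)[OF zero_less_numeral] by (simp add: power_divide)
  next
    case 2
    show ?thesis unfolding m 2(2) 2(1)[OF zero_less_numeral] by (simp add: power_divide)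
  qed
qed

lemma norm_omega_2160:
  assumes "y \<in> omega_2160"
  shows "norm y = 1"
proof -
  have "(\<Sum>i\<in>UNIV. y $ i ^ 2) = 1"
    using assms unfolding omega_2160_eq
  proof (elim UnE)
    assume "y \<in> omega_A"
    then have "card {i. y $ i = 0} = 4" "card {i. \<bar>y $ i\<bar> = 1/2} = 4"
      by (auto simp: omega_A_def)
    from two_values_sum(1)[OF this, of "\<lambda>t. t ^ 2"] show ?thesis
      by (simp add: power_divide)
  next
    assume "y \<in> omega_B"
    then obtain j where "y = axis j 1 \<or> y = - axis j 1"
      by (auto simp: omega_B_def)
    then have "y $ i ^ 2 = (if i = j then 1 else 0)" for i
      by (auto simp: axis_def)
    then show ?thesis by simp
  next
    assume y: "y \<in> omega_C"
    obtain j where j: "\<And>i. \<bar>y $ i\<bar> = (if i = j then 3/4 else 1/4)"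
      using omega_C_E[OF y] by blast
    have "y $ i ^ 2 = 1/16 + (if i = j then 1/2 else 0)" for i
    proof -
      have "y $ i ^ 2 = \<bar>y $ i\<bar> ^ 2" by simp
      then show ?thesis unfolding j by (simp add: power_divide)
    qed
    then show ?thesis by (simp add: sum.distrib)
  qed
  then show ?thesis by (simp add: norm_vec_def L2_set_def)
qed

text \<open>By E8 integrality \<open>2 * sqrt 2 * (x \<bullet> y)\<close> is an integer, and by
  Cauchy-Schwarz its square is at most 8, so its absolute value is at most 2.\<close>

lemma inner_omega_nodes:
  assumes x: "x \<in> omega_240" and y: "y \<in> omega_2160"
  shows "x \<bullet> y \<in> nodes"
proof -
  have "2 * sqrt 2 * (x \<bullet> y) = (\<Sum>i\<in>UNIV. (sqrt 2 * x $ i) * (2 * y $ i))"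
    by (simp add: inner_vec_def sum_distrib_left mult_ac)
  also have "\<dots> \<in> \<int>"
    by (rule E8_vector_inner[OF E8_vector_omega_240[OF x] E8_vector_omega_2160[OF y]])
  finally obtain n where n: "2 * sqrt 2 * (x \<bullet> y) = of_int n"
    by (elim Ints_cases)
  have "\<bar>x \<bullet> y\<bar> \<le> 1"
    using Cauchy_Schwarz_ineq2[of x y] norm_omega_240[OF x] norm_omega_2160[OF y] by simp
  then have "(2 * sqrt 2 * (x \<bullet> y)) ^ 2 \<le> 8"
    using abs_square_le_1[of "x \<bullet> y"] by (simp add: power_mult_distrib)
  then have "n ^ 2 \<le> 8"
    unfolding n by (metis of_int_le_iff of_int_numeral of_int_power)
  then have "\<not> 3 \<le> \<bar>n\<bar>"
    using power_mono[of 3 "\<bar>n\<bar>" 2] by auto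
  then have "n \<in> {-2, -1, 0, 1, 2}" by auto
  moreover have "x \<bullet> y = of_int n / (2 * sqrt 2)"
    unfolding n[symmetric] by simp
  ultimately show ?thesis
    by (auto simp: nodes_def)
qed

text \<open>In the third part all eight coordinates are nonzero, so negation turns \<open>k\<close>
  minus signs into \<open>8 - k\<close>, of the same parity. The symmetry makes the odd moments
  vanish.\<close>

lemma uminus_omega_2160: "uminus ` omega_2160 = omega_2160"
proof -
  have "- y \<in> omega_2160" if "y \<in> omega_2160" for y
    using that unfolding omega_2160_eq
  proof (elim UnE)
    assume y: "y \<in> omega_C"
    obtain j where j: "\<And>i. \<bar>y $ i\<bar> = (if i = j then 3/4 else 1/4)"
      using omega_C_E[OF y] by blast
    have "0 < y $ i \<longleftrightarrow> \<not> y $ i < 0" for i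
      using j[of i] by (auto split: if_splits)
    then have "{i. 0 < y $ i} = - {i. y $ i < 0}"
      by blast
    moreover have "card {i. y $ i < 0} \<le> 8"
      using card_mono[of UNIV "{i. y $ i < 0}"] by simp
    ultimately show "- y \<in> omega_A \<union> omega_B \<union> omega_C"
      using y by (simp add: omega_C_def card_Compl_8)
  qed (auto simp: omega_A_def omega_B_def)
  then have sub: "uminus ` omega_2160 \<subseteq> omega_2160" by blast
  then have "uminus ` uminus ` omega_2160 \<subseteq> uminus ` omega_2160" by (rule image_mono)
  with sub show ?thesis by (simp add: image_image)
qed

lemma moment_2160_odd:
  assumes "odd k"
  shows "moment_2160 k x = 0"
proof -
  have "moment_2160 k x = (\<Sum>y\<in>uminus ` omega_2160. (x \<bullet> y) ^ k)"
    unfolding moment_2160_def uminus_omega_2160 ..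
  also have "\<dots> = - moment_2160 k x"
    using assms by (simp add: sum.reindex moment_2160_def sum_negf)
  finally show ?thesis by simp
qed

lemma sum_poly_omega_2160:
  assumes "degree p \<le> 9" "norm x = 1"
  shows "(\<Sum>y\<in>omega_2160. poly p (x \<bullet> y)) =
    2160 * coeff p 0 + 270 * coeff p 2 + 81 * coeff p 4 + 135 / 4 * coeff p 6 + coeff p 8 * moment_2160 8 x"
proof -
  have "poly p t = (\<Sum>k\<le>9. coeff p k * t ^ k)" for t
    unfolding poly_altdef using assms(1) by (intro sum.mono_neutral_left) (auto simp: coeff_eq_0)
  then have "(\<Sum>y\<in>omega_2160. poly p (x \<bullet> y)) = (\<Sum>k\<le>9. coeff p k * moment_2160 k x)"
    unfolding moment_2160_def sum_distrib_left by (subst sum.swap) simp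
  also have "\<dots> = (\<Sum>k\<in>{0, 1, 2, 3, 4, 5, 6, 7, 8, 9}. coeff p k * moment_2160 k x)"
    by (intro sum.cong) auto
  finally show ?thesis
    using moments_2160(1-4)[OF assms(2)] by (simp add: moment_2160_odd)
qed

section \<open>Minimality and uniqueness\<close>

lemma omega_240_nonempty: "omega_240 \<noteq> {}"
proof -
  have "(\<chi> i. 1 / (2 * sqrt 2)) \<in> omega_240"
    by (simp add: omega_240_def)
  then show ?thesis by blast
qed

theorem theorem4p2:
  fixes g :: "real \<Rightarrow> ereal"
  assumes "admissible_potential g"
    and "\<forall>n<10. nth_deriv n g differentiable_on {-1<..<1}"
    and "\<forall>n\<in>{8, 9, 10}. \<forall>t\<in>{-1<..<1}. nth_deriv n g t \<ge> 0"
  shows "(\<forall>xs\<in>omega_240. is_arg_min (potential_2160 g) (\<lambda>x. x \<in> sphere 0 1) xs) \<and>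
    ((\<forall>t\<in>{-1<..<1}. nth_deriv 10 g t > 0) \<longrightarrow>
      (\<forall>x. is_arg_min (potential_2160 g) (\<lambda>x. x \<in> sphere 0 1) x \<longrightarrow> x \<in> omega_240))"
proof -
  interpret smooth_potential "\<lambda>k. nth_deriv k g"
  proof
    fix k :: nat and t :: real assume k: "k < 10" and t: "t \<in> {-1<..<1}"
    have "nth_deriv k g differentiable (at t within {-1<..<1})"
      using assms(2) k t by (simp add: differentiable_on_def)
    then have "nth_deriv k g differentiable (at t)"
      using at_within_open[OF t] by simp
    then show "(nth_deriv k g has_real_derivative nth_deriv (Suc k) g t) (at t)"
      by (simp only: nth_deriv_def funpow.simps comp_def DERIV_deriv_iff_real_differentiable)
  qed
  obtain p where deg: "degree p \<le> 9" and nodes: "\<forall>x\<in>nodes. nth_deriv 0 g x = poly p x"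
    and le: "\<forall>t\<in>{-1<..<1}. poly p t \<le> nth_deriv 0 g t" and a8: "coeff p 8 \<ge> 0"
    and a8_pos: "(\<forall>t\<in>{-1<..<1}. nth_deriv 10 g t > 0) \<longrightarrow> coeff p 8 > 0"
    using minorant[OF assms(3)] by blast
  \<comment> \<open>The contribution of all moments but the eighth, the same for every point of the
    sphere.\<close>
  define B where "B = 2160 * coeff p 0 + 270 * coeff p 2 + 81 * coeff p 4 + 135 / 4 * coeff p 6"
  have lower: "ereal (B + coeff p 8 * moment_2160 8 x) \<le> potential_2160 g x" if x: "norm x = 1" for x
  proof -
    have "ereal (poly p (x \<bullet> y)) \<le> g (x \<bullet> y)" if y: "y \<in> omega_2160" for y
    proof (rule admissible_ge_poly[OF assms(1)])
      show "poly p t \<le> real_of_ereal (g t)" if "t \<in> {-1<..<1}" for t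
        using le that by (simp add: nth_deriv_def)
      show "x \<bullet> y \<in> {-1..1}"
        using Cauchy_Schwarz_ineq2[of x y] x norm_omega_2160[OF y] by (simp add: abs_le_iff)
    qed
    then have "(\<Sum>y\<in>omega_2160. ereal (poly p (x \<bullet> y))) \<le> potential_2160 g x"
      unfolding potential_2160_def by (rule sum_mono)
    then show ?thesis
      by (simp add: sum_poly_omega_2160[OF deg x] B_def)
  qed
  define V where "V = ereal (B + coeff p 8 * (513 / 32))"
  have attained: "potential_2160 g x = V" if x: "x \<in> omega_240" for x
  proof -
    \<comment> \<open>All inner products are nodes in the open interval, where \<open>g\<close> is
      finite and the interpolation exact.\<close>
    have "g (x \<bullet> y) = ereal (poly p (x \<bullet> y))" if y: "y \<in> omega_2160" for y
    proof -
      have n: "x \<bullet> y \<in> nodes" by (rule inner_omega_nodes[OF x y])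
      then have "x \<bullet> y \<in> {-1<..<1}" using nodes_facts(3) by blast
      then have "\<bar>g (x \<bullet> y)\<bar> \<noteq> \<infinity>"
        using assms(1) unfolding admissible_potential_def by auto
      moreover have "real_of_ereal (g (x \<bullet> y)) = poly p (x \<bullet> y)"
        using nodes n by (simp add: nth_deriv_def)
      ultimately show ?thesis
        by (metis ereal_real')
    qed
    then have "potential_2160 g x = (\<Sum>y\<in>omega_2160. ereal (poly p (x \<bullet> y)))"
      unfolding potential_2160_def by (intro sum.cong) auto
    then show ?thesis
      by (simp add: sum_poly_omega_2160[OF deg norm_omega_240[OF x]] moment_8_omega_240[OF x] B_def V_def)
  qed
  have V_le: "V \<le> potential_2160 g x" if x: "norm x = 1" for x
  proof -
    have "V \<le> ereal (B + coeff p 8 * moment_2160 8 x)"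
      unfolding V_def using mult_left_mono[OF moment_8_ge[OF x] a8] by simp
    then show ?thesis using lower[OF x] by (rule order_trans)
  qed
  show ?thesis
  proof (intro conjI impI ballI allI)
    fix xs assume "xs \<in> omega_240"
    then show "is_arg_min (potential_2160 g) (\<lambda>x. x \<in> sphere 0 1) xs"
      using V_le attained norm_omega_240 by (auto simp: is_arg_min_def not_less)
  next
    fix x
    assume pos: "\<forall>t\<in>{-1<..<1}. nth_deriv 10 g t > 0"
      and min: "is_arg_min (potential_2160 g) (\<lambda>x. x \<in> sphere 0 1) x"
    have x: "norm x = 1" using min by (simp add: is_arg_min_def)
    obtain xs where xs: "xs \<in> omega_240" using omega_240_nonempty by blast
    have "potential_2160 g x \<le> potential_2160 g xs"
      using min norm_omega_240[OF xs] by (simp add: is_arg_min_def not_less)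
    \<comment> \<open>The lower bound at a minimiser cannot exceed \<open>V\<close>; as
      \<open>coeff p 8\<close> is positive, this forces the eighth moment down to its
      minimum.\<close>
    then have "ereal (B + coeff p 8 * moment_2160 8 x) \<le> V"
      using lower[OF x] attained[OF xs] by simp
    then have "coeff p 8 * moment_2160 8 x \<le> coeff p 8 * (513 / 32)"
      by (simp add: V_def)
    then have "moment_2160 8 x \<le> 513 / 32"
      using a8_pos pos by (simp add: mult_le_cancel_left)
    then show "x \<in> omega_240"
      using moment_8_ge[OF x] by (intro moment_8_eq_imp_omega_240[OF x]) simp
  qed
qed

end
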